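(* For all $i,j\in\{0,1,2\}$, the operator $R_{ij}^{\infty}$ (the global part of the second-order Riesz transform $R_{ij}=X_iX_j\Delta^{-1}$) is not bounded from $H^1$ to $L^1$.
   Context: **The group.** $G=\mathbb{R}^2\ltimes\mathbb{R}^+$ is the set $\mathbb{R}^2\times(0,\infty)$ with product $(x_1,x_2,a)\cdot(x_1',x_2',a')=(x_1+a x_1',x_2+a x_2',aa')$ and identity $e=(0,0,1)$. The right Haar measure is $d\rho(x_1,x_2,a)=a^{-1}dx_1dx_2da$; $L^p$ and $\|\cdot\|_p$ are taken with respect to $\rho$. The modular function is $\delta(x_1,x_2,a)=a^{-2}$. $d$ is the left-invariant hyperbolic metric on $G$, and $r(x)=d(x,e)$ is given by $\cosh r(x_1,x_2,a)=\frac{a+a^{-1}+a^{-1}(x_1^2+x_2^2)}{2}$; $B_s$ denotes the ball of centre $e$ and radius $s$ for $d$. Convolution is $f*g(x)=\int_G f(xy^{-1})g(y)\,d\rho(y)$. **Hardy space.** A Calderón–Zygmund set is a parallelepiped $R=[b_1-L/2,b_1+L/2]\times[b_2-L/2,b_2+L/2]\times[a e^{-r},a e^{r}]$, where $b_1,b_2\in\mathbb{R}$ and $L>0$, $r>0$, $a\in\mathbb{R}^+$ satisfy $e^2ar\le L<e^8ar$ if $r<1$, and $ae^{2r}\le L<ae^{8r}$ if $r\ge1$. An atom is a function $A\in L^1$ supported in a Calderón–Zygmund set $R$ with $\|A\|_\infty\le\rho(R)^{-1}$ and $\int A\,d\rho=0$. $H^1$ is the space of all $f\in L^1$ of the form $f=\sum_j\lambda_jA_j$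 with $A_j$ atoms, $\lambda_j\in\mathbb{C}$, $\sum_j|\lambda_j|<\infty$; $\|f\|_{H^1}$ is the infimum of $\sum_j|\lambda_j|$ over such decompositions. **Operators.** Let $X_0=a\partial_a$, $X_1=a\partial_{x_1}$, $X_2=a\partial_{x_2}$ (left-invariant vector fields), $\Delta=-(X_0^2+X_1^2+X_2^2)$, and $W(x)=\frac{1}{4\pi}\delta^{1/2}(x)\frac{1}{\sinh r(x)}$, the convolution kernel of $\Delta^{-1}$. The convolution kernel of $R_{ij}$ is $k_{ij}=X_iX_jW$ (distributional derivative), a smooth function on $G\setminus\{e\}$. Fix $\Psi\in C_c^\infty(G)$ with $0\le\Psi\le1$, $\Psi$ supported in $B_2$ and $\Psi=1$ on $B_1$; set $k_{ij}^\infty=k_{ij}(1-\Psi)$ and $R_{ij}^\infty f=f*k_{ij}^\infty$ for $f\in C_c^\infty(G)$. An operator $T$ defined on $C_c^\infty(G)$ is said to be bounded from $H^1$ to $L^1$ if there is a constant $C$ such that $\|Tf\|_1\le C\|f\|_{H^1}$ for all $f\in C_c^\infty(G)\cap H^1$ (with $\|Tf\|_1=\infty$ if $Tf\notin L^1$). *)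

theory Defs
  imports "HOL-Analysis.Analysis"
begin

section \<open>The group\<close>

text \<open>
  The group is the open half-space \<open>G\<close> of \<^typ>\<open>real \<times> real \<times> real\<close>.
  Functions on the group are represented by functions on the whole of
  \<^typ>\<open>real \<times> real \<times> real\<close>; none of the notions below depends on their values
  outside \<open>G\<close>.
\<close>

type_synonym pt = "real \<times> real \<times> real"

definition G :: "pt set" where
  "G = {(x1, x2, a). a > 0}"

definition gmult :: "pt \<Rightarrow> pt \<Rightarrow> pt" where
  "gmult = (\<lambda>(x1, x2, a) (x1', x2', a'). (x1 + a * x1', x2 + a * x2', a * a'))"

definition gone :: pt where
  "gone = (0, 0, 1)"

definition ginv :: "pt \<Rightarrow> pt" where
  "ginv = (\<lambda>(x1, x2, a). (- x1 / a, - x2 / a, 1 / a))"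

lemma ginv_right: "x \<in> G \<Longrightarrow> gmult x (ginv x) = gone"
  and ginv_left: "x \<in> G \<Longrightarrow> gmult (ginv x) x = gone"
  by (auto simp: G_def gmult_def ginv_def gone_def)

definition haar :: "pt measure" where
  "haar = density (restrict_space lborel G) (\<lambda>(x1, x2, a). ennreal (1 / a))"

definition modular :: "pt \<Rightarrow> real" where
  "modular = (\<lambda>(x1, x2, a). a powi (- 2))"

definition hrad :: "pt \<Rightarrow> real" where
  "hrad = (\<lambda>(x1, x2, a). arcosh ((a + 1 / a + (x1\<^sup>2 + x2\<^sup>2) / a) / 2))"

lemma cosh_hrad:
  assumes "(x1, x2, a) \<in> G"
  shows "cosh (hrad (x1, x2, a)) = (a + 1 / a + (x1\<^sup>2 + x2\<^sup>2) / a) / 2"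
    and "hrad (x1, x2, a) \<ge> 0"
proof -
  have a: "a > 0" using assms by (simp add: G_def)
  have "0 \<le> (a - 1)\<^sup>2 / a" using a by simp
  also have "(a - 1)\<^sup>2 / a = a + 1 / a - 2"
    using a by (simp add: power2_eq_square field_simps)
  finally have "a + 1 / a \<ge> 2" by simp
  moreover have "(x1\<^sup>2 + x2\<^sup>2) / a \<ge> 0" using a by simp
  ultimately have "(a + 1 / a + (x1\<^sup>2 + x2\<^sup>2) / a) / 2 \<ge> 1" by argo
  then show "cosh (hrad (x1, x2, a)) = (a + 1 / a + (x1\<^sup>2 + x2\<^sup>2) / a) / 2"
    and "hrad (x1, x2, a) \<ge> 0"
    by (auto simp: hrad_def)
qed

definition hball :: "real \<Rightarrow> pt set" where
  "hball s = {x \<in> G. hrad x < s}"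

definition conv :: "(pt \<Rightarrow> complex) \<Rightarrow> (pt \<Rightarrow> complex) \<Rightarrow> pt \<Rightarrow> complex" where
  "conv f g x = (\<integral>y. f (gmult x (ginv y)) * g y \<partial>haar)"

definition L1norm :: "(pt \<Rightarrow> complex) \<Rightarrow> ennreal" where
  "L1norm f = (if integrable haar f then \<integral>\<^sup>+x. ennreal (norm (f x)) \<partial>haar else \<infinity>)"


section \<open>Test functions\<close>

text \<open>
  \<open>Ck_on k S f\<close> is meant for open \<open>S\<close>: all directional derivatives of \<open>f\<close> of order
  at most \<open>k\<close> exist and are continuous on \<open>S\<close>.
\<close>

primrec Ck_on ::
  "nat \<Rightarrow> 'a::real_normed_vector set \<Rightarrow> ('a \<Rightarrow> 'b::real_normed_vector) \<Rightarrow> bool" where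
  "Ck_on 0 S f \<longleftrightarrow> continuous_on S f"
| "Ck_on (Suc k) S f \<longleftrightarrow>
     (\<forall>x\<in>S. f differentiable (at x)) \<and>
     (\<forall>v. Ck_on k S (\<lambda>x. frechet_derivative f (at x) v))"

definition smooth_on ::
  "'a::real_normed_vector set \<Rightarrow> ('a \<Rightarrow> 'b::real_normed_vector) \<Rightarrow> bool" where
  "smooth_on S f \<longleftrightarrow> (\<forall>k. Ck_on k S f)"

definition test_functions :: "(pt \<Rightarrow> 'b::real_normed_vector) set" where
  "test_functions =
     {f. smooth_on G f \<and> (\<exists>K. compact K \<and> K \<subseteq> G \<and> (\<forall>x\<in>G - K. f x = 0))}"


section \<open>The atomic Hardy space\<close>

definition CZ_sets :: "pt set set" where
  "CZ_sets =
     {{b1 - L/2 .. b1 + L/2} \<times> {b2 - L/2 .. b2 + L/2} \<times> {a * exp (- r) .. a * exp r} |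
        b1 b2 L r a.
        L > 0 \<and> r > 0 \<and> a > 0 \<and>
        (r < 1 \<longrightarrow> exp 2 * a * r \<le> L \<and> L < exp 8 * a * r) \<and>
        (r \<ge> 1 \<longrightarrow> a * exp (2 * r) \<le> L \<and> L < a * exp (8 * r))}"

definition atom :: "(pt \<Rightarrow> complex) \<Rightarrow> bool" where
  "atom A \<longleftrightarrow> integrable haar A \<and>
     (\<exists>R\<in>CZ_sets. (AE x in haar. x \<notin> R \<longrightarrow> A x = 0) \<and>
                  (AE x in haar. norm (A x) \<le> 1 / measure haar R)) \<and>
     (\<integral>x. A x \<partial>haar) = 0"

text \<open>
  The series of atoms converges in \<open>L\<^sup>1\<close>. Since \<open>0\<close> is an atom, finite sums are included.
\<close>

definition atomic_decomposition ::
  "(pt \<Rightarrow> complex) \<Rightarrow> (nat \<Rightarrow> complex) \<Rightarrow> (nat \<Rightarrow> pt \<Rightarrow> complex) \<Rightarrow> bool" where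
  "atomic_decomposition f c A \<longleftrightarrow>
     (\<forall>j. atom (A j)) \<and> summable (\<lambda>j. norm (c j)) \<and>
     (\<lambda>n. L1norm (\<lambda>x. f x - (\<Sum>j<n. c j * A j x))) \<longlonglongrightarrow> 0"

definition H1 :: "(pt \<Rightarrow> complex) set" where
  "H1 = {f. integrable haar f \<and> (\<exists>c A. atomic_decomposition f c A)}"

definition H1norm :: "(pt \<Rightarrow> complex) \<Rightarrow> real" where
  "H1norm f = Inf {\<Sum>j. norm (c j) | c A. atomic_decomposition f c A}"

definition bounded_H1_L1 :: "((pt \<Rightarrow> complex) \<Rightarrow> (pt \<Rightarrow> complex)) \<Rightarrow> bool" where
  "bounded_H1_L1 T \<longleftrightarrow>
     (\<exists>C::real. C \<ge> 0 \<and> (\<forall>f \<in> test_functions \<inter> H1. L1norm (T f) \<le> ennreal (C * H1norm f)))"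


section \<open>Second-order Riesz transforms at infinity\<close>

definition vfield :: "nat \<Rightarrow> (pt \<Rightarrow> real) \<Rightarrow> pt \<Rightarrow> real" where
  "vfield i f = (\<lambda>(x1, x2, a).
     a * (if i = 0 then deriv (\<lambda>t. f (x1, x2, t)) a
          else if i = 1 then deriv (\<lambda>t. f (t, x2, a)) x1
          else deriv (\<lambda>t. f (x1, t, a)) x2))"

definition Wker :: "pt \<Rightarrow> real" where
  "Wker x = 1 / (4 * pi) * sqrt (modular x) * (1 / sinh (hrad x))"

text \<open>
  On \<open>G - {gone}\<close>, where \<open>Wker\<close> is smooth, its distributional derivatives are the classical
  ones. The value of \<open>Riesz_kernel\<close> at \<open>gone\<close> is meaningless, and the singular part at
  \<open>gone\<close> of the distributional kernel is not represented; neither plays a role after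
  multiplication by \<open>1 - \<Psi>\<close>, which vanishes near \<open>gone\<close>.
\<close>

definition Riesz_kernel :: "nat \<Rightarrow> nat \<Rightarrow> pt \<Rightarrow> real" where
  "Riesz_kernel i j = vfield i (vfield j Wker)"

definition Riesz_kernel_global :: "(pt \<Rightarrow> real) \<Rightarrow> nat \<Rightarrow> nat \<Rightarrow> pt \<Rightarrow> real" where
  "Riesz_kernel_global \<Psi> i j x = Riesz_kernel i j x * (1 - \<Psi> x)"

definition Riesz_global ::
  "(pt \<Rightarrow> real) \<Rightarrow> nat \<Rightarrow> nat \<Rightarrow> (pt \<Rightarrow> complex) \<Rightarrow> pt \<Rightarrow> complex" where
  "Riesz_global \<Psi> i j f = conv f (\<lambda>x. complex_of_real (Riesz_kernel_global \<Psi> i j x))"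

end

theory Submission
  imports Defs
begin

text \<open>
  Where \<open>\<bar>x\<bar> + a\<close> is large, the kernel \<open>k = X\<^sub>i X\<^sub>j W\<close> is a perturbation of a kernel \<open>K\<close> that is
  homogeneous of degree \<open>- 2\<close> under the dilations \<open>(x, a) \<mapsto> (c x, c a)\<close> of the half space.
  The measure \<open>\<rho>\<close> has homogeneous dimension 2, so every dyadic range of heights contributes the same
  amount to \<open>\<integral> \<bar>K\<bar> d\<rho>\<close>, and the global operator sees all scales at once. At a
  height \<open>u\<close> far above the support of a function \<open>f(z', c) = g(z') \<beta>(c)\<close> it acts approximately as
  convolution of \<open>g\<close> on the plane with the \<open>L\<^sup>1\<close>-normalised dilate \<open>K(\<cdot>, u)\<close>, times \<open>\<integral> \<beta> dc/c\<close>.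

  A Calderon-Zygmund set centred at height 1 with large parameter \<open>r\<close> has heights up to \<open>e\<^sup>r\<close> and side at least
  \<open>e\<^sup>2\<^sup>r\<close>. This leaves about \<open>r\<close> independent scales between the top of the set and its width.
  Fix \<open>n\<close>, put \<open>e\<^sup>r \<approx> 2\<^sup>n\<close>, and cut the square of side \<open>\<approx> 4\<^sup>n\<close> into cells of side \<open>\<approx> 2\<^bsup>n+k\<^esup>\<close>, for
  each \<open>k < n\<close>. Every cell \<open>m\<close> carries a dipole \<open>\<phi>\<^sub>m\<close>: one bump minus a translate of it. With
  signs \<open>s\<^sub>m\<close> form the Riesz product \<open>\<Prod>\<^sub>m (1 + \<i> s\<^sub>m \<phi>\<^sub>m / \<surd>n)\<close>. At each point at most one dipole per
  scale is nonzero, so the product is bounded independently of \<open>n\<close>; after subtraction of a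
  weighted mean and multiplication by a cutoff it is a multiple of an atom, with \<open>H\<^sup>1\<close>-norm \<open>O(\<rho>(R))\<close>.

  On the other hand, averaging over the signs after multiplication by \<open>s\<^sub>m\<close> isolates the term
  \<open>\<i> \<phi>\<^sub>m / \<surd>n\<close>. On a box \<open>D\<^sub>m\<close> at height comparable to the side of the cell the convolution of
  \<open>\<beta> \<phi>\<^sub>m\<close> with \<open>k\<close> has modulus at least a constant times \<open>n\<close>, because \<open>K\<close> takes different values at the
  two points that the dipole compares: \<open>K(1, 1, 1) \<noteq> K(0, 0, 1)\<close> for all nine pairs \<open>(i, j)\<close>. Hence the
  average over the signs of \<open>\<bar>T f\<bar>\<close> is at least a constant times \<open>n / \<surd>n\<close> on every \<open>D\<^sub>m\<close>. The boxes
  are disjoint with total measure comparable to \<open>n 16\<^sup>n\<close>, while \<open>\<rho>(R)\<close> is comparable to \<open>n 16\<^sup>n\<close>.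
  Boundedness with constant \<open>C\<close> would give \<open>\<surd>n = O(C)\<close> for all large \<open>n\<close>.

  The estimate on \<open>D\<^sub>m\<close> is \<open>dipole_conv_lower\<close>, the averaging is \<open>sum_norm_TK_lower\<close>, the atom
  bound is \<open>H1norm_test_fun\<close>, and \<open>sqrt_growth\<close> compares them.
\<close>


section \<open>Calculus of \<open>Ck_on\<close>\<close>

lemma Ck_on_cong:
  assumes "open S" "\<And>x. x \<in> S \<Longrightarrow> f x = g x" "Ck_on k S f"
  shows "Ck_on k S g"
  using assms(2,3)
proof (induction k arbitrary: f g)
  case 0 then show ?case by (simp cong: continuous_on_cong)
next
  case (Suc k)
  have d: "g differentiable (at x) \<and> frechet_derivative g (at x) = frechet_derivative f (at x)"
    if "x \<in> S" for x
  proof -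
    have "(f has_derivative frechet_derivative f (at x)) (at x)"
      using Suc.prems(2) that by (simp add: frechet_derivative_works)
    then have "(g has_derivative frechet_derivative f (at x)) (at x)"
      using has_derivative_transform_within_open[OF _ \<open>open S\<close> that] Suc.prems(1) by blast
    then show ?thesis
      using frechet_derivative_at[of g "frechet_derivative f (at x)" x]
        differentiableI[of g "frechet_derivative f (at x)" "at x"] by metis
  qed
  have "Ck_on k S (\<lambda>x. frechet_derivative g (at x) v)" for v
  proof (rule Suc.IH)
    show "Ck_on k S (\<lambda>x. frechet_derivative f (at x) v)" using Suc.prems(2) by simp
    show "frechet_derivative f (at x) v = frechet_derivative g (at x) v" if "x \<in> S" for x
      using d[OF that] by metis
  qed
  with d show ?case by simp
qed

text \<open>
  Any formula for the derivative may replace \<open>frechet_derivative\<close>, whose values off \<open>S\<close> are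
  arbitrary; this is why a congruence on open sets comes first.
\<close>

lemma Ck_on_Suc_I:
  assumes "open S" "\<And>x. x \<in> S \<Longrightarrow> (f has_derivative D x) (at x)"
    "\<And>v. Ck_on k S (\<lambda>x. D x v)"
  shows "Ck_on (Suc k) S f"
proof -
  have eq: "D x v = frechet_derivative f (at x) v" if "x \<in> S" for x v
    using frechet_derivative_at[OF assms(2)[OF that]] by simp
  have "Ck_on k S (\<lambda>x. frechet_derivative f (at x) v)" for v
    by (rule Ck_on_cong[OF assms(1) eq assms(3)])
  then show ?thesis
    by (simp add: differentiableI[OF assms(2)])
qed

lemma Ck_on_Suc_D: "Ck_on (Suc k) S f \<Longrightarrow> Ck_on k S f"
proof (induction k arbitrary: f)
  case 0
  then show ?case
    by (auto intro!: continuous_at_imp_continuous_on differentiable_imp_continuous_within)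
qed auto

lemma Ck_on_const: "open S \<Longrightarrow> Ck_on k S (\<lambda>x. c)"
proof (induction k arbitrary: c)
  case (Suc k)
  show ?case by (rule Ck_on_Suc_I[where D = "\<lambda>x v. 0"]) (use Suc in auto)
qed simp

lemma Ck_on_add:
  assumes "open S" "Ck_on k S f" "Ck_on k S g"
  shows "Ck_on k S (\<lambda>x. f x + g x)"
  using assms(2,3)
proof (induction k arbitrary: f g)
  case (Suc k)
  show ?case
    by (rule Ck_on_Suc_I[where D = "\<lambda>x v. frechet_derivative f (at x) v + frechet_derivative g (at x) v"])
       (use Suc assms(1) in \<open>auto intro!: has_derivative_add simp: frechet_derivative_works\<close>)
qed (auto intro: continuous_on_add)

lemma Ck_on_mult:
  fixes f g :: "'a::real_normed_vector \<Rightarrow> 'b::real_normed_algebra"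
  assumes "open S" "Ck_on k S f" "Ck_on k S g"
  shows "Ck_on k S (\<lambda>x. f x * g x)"
  using assms(2,3)
proof (induction k arbitrary: f g)
  case (Suc k)
  show ?case
  proof (rule Ck_on_Suc_I[OF \<open>open S\<close>])
    show "((\<lambda>x. f x * g x) has_derivative
        (\<lambda>v. f x * frechet_derivative g (at x) v + frechet_derivative f (at x) v * g x)) (at x)"
      if "x \<in> S" for x
      using Suc.prems that by (auto intro!: has_derivative_mult simp: frechet_derivative_works)
    show "Ck_on k S (\<lambda>x. f x * frechet_derivative g (at x) v + frechet_derivative f (at x) v * g x)" for v
      using Suc.prems Ck_on_Suc_D[OF Suc.prems(1)] Ck_on_Suc_D[OF Suc.prems(2)]
      by (intro Ck_on_add[OF \<open>open S\<close>] Suc.IH) auto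
  qed
qed (auto intro: continuous_on_mult)

lemma Ck_on_linear_comp:
  assumes "open S" "bounded_linear B" "Ck_on k S f"
  shows "Ck_on k S (\<lambda>x. B (f x))"
  using assms(3)
proof (induction k arbitrary: f)
  case 0 then show ?case using assms(2) by (auto intro: bounded_linear.continuous_on)
next
  case (Suc k)
  show ?case
  proof (rule Ck_on_Suc_I[OF \<open>open S\<close>])
    show "((\<lambda>x. B (f x)) has_derivative (\<lambda>v. B (frechet_derivative f (at x) v))) (at x)"
      if "x \<in> S" for x
      using Suc.prems that
      by (intro bounded_linear.has_derivative[OF assms(2)]) (simp add: frechet_derivative_works)
  qed (use Suc in auto)
qed

lemma Ck_on_affine_comp:
  assumes "open S" "bounded_linear A" "\<And>x. x \<in> S \<Longrightarrow> A x + c \<in> V" "Ck_on k V f"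
  shows "Ck_on k S (\<lambda>x. f (A x + c))"
  using assms(4)
proof (induction k arbitrary: f)
  case 0
  then have "continuous_on V f" by simp
  moreover have "continuous_on S (\<lambda>x. A x + c)"
    using assms(2) by (intro continuous_intros linear_continuous_on)
  ultimately have "continuous_on S (\<lambda>x. f (A x + c))"
    by (rule continuous_on_compose2) (use assms(3) in auto)
  then show ?case by simp
next
  case (Suc k)
  show ?case
  proof (rule Ck_on_Suc_I[OF \<open>open S\<close>])
    show "((\<lambda>x. f (A x + c)) has_derivative (\<lambda>v. frechet_derivative f (at (A x + c)) (A v))) (at x)"
      if "x \<in> S" for x
    proof -
      have 1: "((\<lambda>x. A x + c) has_derivative A) (at x)"
        using has_derivative_add[OF bounded_linear_imp_has_derivative[OF assms(2)] has_derivative_const]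
        by simp
      have 2: "(f has_derivative frechet_derivative f (at (A x + c))) (at (A x + c))"
        using Suc.prems assms(3)[OF that] by (auto simp: frechet_derivative_works)
      show ?thesis using has_derivative_compose[OF 1 2] by simp
    qed
  qed (use Suc in auto)
qed

lemma open_G: "open G"
proof -
  have "G = UNIV \<times> UNIV \<times> {0<..}" by (auto simp: G_def)
  moreover have "open (UNIV \<times> UNIV \<times> {0<..} :: pt set)"
    by (intro open_Times) auto
  ultimately show ?thesis by simp
qed


section \<open>Haar integrals in coordinates\<close>

lemma space_haar [simp]: "space haar = G"
  by (simp add: haar_def space_restrict_space)

lemma sets_haar: "sets haar = sets (restrict_space borel G)"
  by (simp add: haar_def sets_restrict_space)

lemma borel_measurable_haar:
  "f \<in> borel_measurable borel \<Longrightarrow> f \<in> borel_measurable haar"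
  using measurable_restrict_space1[of f borel _ G] sets_haar measurable_cong_sets by blast

lemma in_sets_haar: "A \<in> sets borel \<Longrightarrow> A \<subseteq> G \<Longrightarrow> A \<in> sets haar"
  unfolding sets_haar using open_G by (simp add: sets_restrict_space_iff)

lemma borel_pt: "(borel :: pt measure) = borel \<Otimes>\<^sub>M borel \<Otimes>\<^sub>M borel"
  by (simp add: borel_prod)

lemma nn_integral_haar_iterated:
  fixes g :: "pt \<Rightarrow> ennreal"
  assumes [measurable]: "g \<in> borel_measurable borel"
  shows "(\<integral>\<^sup>+y. g y \<partial>haar) =
    (\<integral>\<^sup>+b. indicator {0<..} b * ennreal (1 / b) *
       (\<integral>\<^sup>+y2. \<integral>\<^sup>+y1. g (y1, y2, b) \<partial>lborel \<partial>lborel) \<partial>lborel)"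
proof -
  have [measurable]: "g \<in> borel_measurable (borel \<Otimes>\<^sub>M borel \<Otimes>\<^sub>M borel)"
    using assms borel_pt by simp
  define h :: "pt \<Rightarrow> ennreal" where
    "h = (\<lambda>(y1, y2, b). indicator {0<..} b * ennreal (1 / b) * g (y1, y2, b))"
  have h [measurable]: "h \<in> borel_measurable (borel \<Otimes>\<^sub>M borel \<Otimes>\<^sub>M borel)"
    unfolding h_def by measurable
  have d: "(\<lambda>(x1::real, x2::real, a::real). ennreal (1 / a)) \<in> borel_measurable borel"
    unfolding borel_pt by measurable
  have G: "G \<inter> space lborel \<in> sets lborel" using open_G by simp
  have "(\<integral>\<^sup>+y. g y \<partial>haar) =
      (\<integral>\<^sup>+y. (\<lambda>(x1, x2, a). ennreal (1 / a)) y * g y \<partial>restrict_space lborel G)"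
    unfolding haar_def
    by (rule nn_integral_density; rule measurable_restrict_space1) (use assms d in auto)
  also have "\<dots> = (\<integral>\<^sup>+y. (\<lambda>(x1, x2, a). ennreal (1 / a)) y * g y * indicator G y \<partial>lborel)"
    by (rule nn_integral_restrict_space[OF G])
  also have "\<dots> = (\<integral>\<^sup>+y. h y \<partial>lborel)"
    by (intro nn_integral_cong) (auto simp: h_def G_def indicator_def)
  also have "\<dots> = (\<integral>\<^sup>+y. h y \<partial>(lborel \<Otimes>\<^sub>M lborel))"
    by (simp add: lborel_prod)
  also have "\<dots> = (\<integral>\<^sup>+z. \<integral>\<^sup>+y1. h (y1, z) \<partial>lborel \<partial>lborel)"
    by (subst lborel_pair.nn_integral_snd[symmetric]) (use h borel_pt in \<open>simp_all add: lborel_prod\<close>)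
  also have "\<dots> = (\<integral>\<^sup>+z. \<integral>\<^sup>+y1. h (y1, z) \<partial>lborel \<partial>(lborel \<Otimes>\<^sub>M lborel))"
    by (simp add: lborel_prod)
  also have "\<dots> = (\<integral>\<^sup>+b. \<integral>\<^sup>+y2. \<integral>\<^sup>+y1. h (y1, y2, b) \<partial>lborel \<partial>lborel \<partial>lborel)"
    by (subst lborel_pair.nn_integral_snd[symmetric]) simp_all
  also have "\<dots> = (\<integral>\<^sup>+b. indicator {0<..} b * ennreal (1 / b) *
       (\<integral>\<^sup>+y2. \<integral>\<^sup>+y1. g (y1, y2, b) \<partial>lborel \<partial>lborel) \<partial>lborel)"
    by (simp add: h_def nn_integral_cmult)
  finally show ?thesis .
qed

text \<open>
  The horizontal affine substitution may depend on the height \<open>b\<close>, as it does for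
  \<open>y \<mapsto> x y\<^sup>-\<^sup>1\<close>. The right-hand side contains neither \<open>o1\<close> nor \<open>o2\<close>: this is the
  invariance under horizontal translation on which the cancellation of dipoles rests.
\<close>

lemma nn_integral_haar_product:
  fixes P Q :: "real \<Rightarrow> ennreal" and B :: "real \<Rightarrow> ennreal" and s o1 o2 :: "real \<Rightarrow> real"
  assumes [measurable]: "P \<in> borel_measurable borel" "Q \<in> borel_measurable borel"
    "B \<in> borel_measurable borel" "s \<in> borel_measurable borel"
    "o1 \<in> borel_measurable borel" "o2 \<in> borel_measurable borel"
  assumes s: "\<And>b. b > 0 \<Longrightarrow> s b \<noteq> 0"
  shows "(\<integral>\<^sup>+(y1, y2, b). B b * P (o1 b + s b * y1) * Q (o2 b + s b * y2) \<partial>haar) =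
    (\<integral>\<^sup>+b. indicator {0<..} b * (B b * ennreal (1 / (b * (s b)\<^sup>2))) \<partial>lborel)
      * (\<integral>\<^sup>+t. P t \<partial>lborel) * (\<integral>\<^sup>+t. Q t \<partial>lborel)"
proof -
  have inner: "(\<integral>\<^sup>+t. F (c + r * t) \<partial>lborel) = ennreal (1 / \<bar>r\<bar>) * (\<integral>\<^sup>+t. F t \<partial>lborel)"
    if "r \<noteq> 0" and [measurable]: "F \<in> borel_measurable borel" for F :: "real \<Rightarrow> ennreal" and c r
  proof -
    have "ennreal (1 / \<bar>r\<bar>) * (\<integral>\<^sup>+t. F t \<partial>lborel) =
        (ennreal (1 / \<bar>r\<bar>) * ennreal \<bar>r\<bar>) * (\<integral>\<^sup>+t. F (c + r * t) \<partial>lborel)"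
      by (subst nn_integral_real_affine[where c = r and t = c]) (use that in \<open>simp_all add: mult.assoc\<close>)
    then show ?thesis using that by (simp add: ennreal_mult[symmetric])
  qed
  have [measurable]: "(\<lambda>(y1, y2, b). B b * P (o1 b + s b * y1) * Q (o2 b + s b * y2))
      \<in> borel_measurable borel"
    unfolding borel_pt by measurable
  have "(\<integral>\<^sup>+(y1, y2, b). B b * P (o1 b + s b * y1) * Q (o2 b + s b * y2) \<partial>haar) =
     (\<integral>\<^sup>+b. indicator {0<..} b * ennreal (1 / b) *
       (\<integral>\<^sup>+y2. \<integral>\<^sup>+y1. B b * P (o1 b + s b * y1) * Q (o2 b + s b * y2) \<partial>lborel \<partial>lborel) \<partial>lborel)"
    by (subst nn_integral_haar_iterated) simp_all
  also have "\<dots> = (\<integral>\<^sup>+b. indicator {0<..} b * (B b * ennreal (1 / (b * (s b)\<^sup>2)))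
      * ((\<integral>\<^sup>+t. P t \<partial>lborel) * (\<integral>\<^sup>+t. Q t \<partial>lborel)) \<partial>lborel)"
  proof (rule nn_integral_cong)
    fix b :: real
    show "indicator {0<..} b * ennreal (1 / b) *
       (\<integral>\<^sup>+y2. \<integral>\<^sup>+y1. B b * P (o1 b + s b * y1) * Q (o2 b + s b * y2) \<partial>lborel \<partial>lborel) =
       indicator {0<..} b * (B b * ennreal (1 / (b * (s b)\<^sup>2)))
      * ((\<integral>\<^sup>+t. P t \<partial>lborel) * (\<integral>\<^sup>+t. Q t \<partial>lborel))"
    proof (cases "b > 0")
      case True
      have "(\<integral>\<^sup>+y2. \<integral>\<^sup>+y1. B b * P (o1 b + s b * y1) * Q (o2 b + s b * y2) \<partial>lborel \<partial>lborel)
         = B b * (\<integral>\<^sup>+y1. P (o1 b + s b * y1) \<partial>lborel) * (\<integral>\<^sup>+y2. Q (o2 b + s b * y2) \<partial>lborel)"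
        by (simp add: nn_integral_multc nn_integral_cmult)
      also have "\<dots> = B b * (ennreal (1 / \<bar>s b\<bar>) * (\<integral>\<^sup>+t. P t \<partial>lborel))
          * (ennreal (1 / \<bar>s b\<bar>) * (\<integral>\<^sup>+t. Q t \<partial>lborel))"
        using s[OF True] by (simp add: inner)
      finally have "(\<integral>\<^sup>+y2. \<integral>\<^sup>+y1. B b * P (o1 b + s b * y1) * Q (o2 b + s b * y2) \<partial>lborel \<partial>lborel)
          = B b * (ennreal (1 / \<bar>s b\<bar>) * ennreal (1 / \<bar>s b\<bar>))
            * ((\<integral>\<^sup>+t. P t \<partial>lborel) * (\<integral>\<^sup>+t. Q t \<partial>lborel))"
        by (simp add: ac_simps)
      moreover have "ennreal (1 / (b * (s b)\<^sup>2)) =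
          ennreal (1 / b) * (ennreal (1 / \<bar>s b\<bar>) * ennreal (1 / \<bar>s b\<bar>))"
        using True by (simp add: ennreal_mult[symmetric] power2_eq_square)
      ultimately show ?thesis using True by (simp add: ac_simps)
    qed simp
  qed
  also have "\<dots> = (\<integral>\<^sup>+b. indicator {0<..} b * (B b * ennreal (1 / (b * (s b)\<^sup>2))) \<partial>lborel)
      * ((\<integral>\<^sup>+t. P t \<partial>lborel) * (\<integral>\<^sup>+t. Q t \<partial>lborel))"
    by (rule nn_integral_multc) measurable
  finally show ?thesis by (simp add: ac_simps)
qed

lemma nn_integral_inverse:
  assumes "0 < p" "p \<le> q"
  shows "(\<integral>\<^sup>+b. ennreal (1 / b) * indicator {p..q} b \<partial>lborel) = ennreal (ln (q / p))"
proof -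
  have "(\<integral>\<^sup>+b. ennreal (1 / b) * indicator {p..q} b \<partial>lborel) = ennreal (ln q - ln p)"
    by (rule nn_integral_FTC_Icc) (use assms in \<open>auto intro!: derivative_eq_intros simp: divide_simps\<close>)
  then show ?thesis using assms by (simp add: ln_div)
qed

lemma emeasure_haar_box:
  assumes "a1 \<le> b1" "a2 \<le> b2" "0 < p" "p \<le> q"
  shows "emeasure haar ({a1..b1} \<times> {a2..b2} \<times> {p..q}) =
    ennreal ((b1 - a1) * (b2 - a2) * ln (q / p))"
proof -
  let ?X = "{a1..b1} \<times> {a2..b2} \<times> {p..q} :: pt set"
  have "?X \<in> sets haar"
    by (rule in_sets_haar) (use assms in \<open>auto simp: G_def intro!: borel_closed closed_Times\<close>)
  then have "emeasure haar ?X = (\<integral>\<^sup>+y. indicator ?X y \<partial>haar)" by simp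
  also have "\<dots> = (\<integral>\<^sup>+(y1, y2, b). indicator {p..q} b * indicator {a1..b1} (0 + 1 * y1) *
      indicator {a2..b2} (0 + 1 * y2) \<partial>haar)"
    by (intro nn_integral_cong) (auto simp: indicator_def)
  also have "\<dots> = (\<integral>\<^sup>+b. indicator {0<..} b * (indicator {p..q} b * ennreal (1 / (b * 1\<^sup>2))) \<partial>lborel)
      * (\<integral>\<^sup>+t. indicator {a1..b1} t \<partial>lborel) * (\<integral>\<^sup>+t. indicator {a2..b2} t \<partial>lborel)"
    by (rule nn_integral_haar_product) simp_all
  also have "(\<integral>\<^sup>+b. indicator {0<..} b * (indicator {p..q} b * ennreal (1 / (b * 1\<^sup>2))) \<partial>lborel)
     = (\<integral>\<^sup>+b. ennreal (1 / b) * indicator {p..q} b \<partial>lborel)"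
    by (intro nn_integral_cong) (use assms in \<open>auto simp: indicator_def\<close>)
  also have "\<dots> = ennreal (ln (q / p))" by (rule nn_integral_inverse) fact+
  finally show ?thesis
    using assms by (simp add: ennreal_mult[symmetric] mult_ac)
qed

lemma box_sets_haar:
  "0 < p \<Longrightarrow> {a1..b1} \<times> {a2..b2} \<times> {p..q} \<in> sets haar"
  by (rule in_sets_haar) (auto simp: G_def intro!: borel_closed closed_Times)

lemma integrable_haar_bounded:
  fixes f :: "pt \<Rightarrow> 'b::{banach, second_countable_topology}"
  assumes "f \<in> borel_measurable borel" "0 < p"
    and "\<And>x. x \<in> {a1..b1} \<times> {a2..b2} \<times> {p..q} \<Longrightarrow> norm (f x) \<le> M"
    and "\<And>x. x \<in> G \<Longrightarrow> x \<notin> {a1..b1} \<times> {a2..b2} \<times> {p..q} \<Longrightarrow> f x = 0"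
  shows "integrable haar f"
proof (rule integrableI_bounded_set[where A = "{a1..b1} \<times> {a2..b2} \<times> {p..q}" and B = M])
  show "{a1..b1} \<times> {a2..b2} \<times> {p..q} \<in> sets haar" using assms(2) by (rule box_sets_haar)
  show "f \<in> borel_measurable haar" using assms(1) by (rule borel_measurable_haar)
  show "emeasure haar ({a1..b1} \<times> {a2..b2} \<times> {p..q}) < \<infinity>"
  proof (cases "a1 \<le> b1 \<and> a2 \<le> b2 \<and> p \<le> q")
    case True then show ?thesis using assms(2) by (simp add: emeasure_haar_box)
  next
    case False
    then have e: "{a1..b1} \<times> {a2..b2} \<times> {p..q} = {}" by auto
    show ?thesis unfolding e by simp
  qed
  show "AE x in haar. x \<in> {a1..b1} \<times> {a2..b2} \<times> {p..q} \<longrightarrow> norm (f x) \<le> M"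
    using assms(3) by (intro AE_I2) simp
  show "AE x in haar. x \<notin> {a1..b1} \<times> {a2..b2} \<times> {p..q} \<longrightarrow> f x = 0"
    using assms(4) by (intro AE_I2) simp
qed


section \<open>The Riesz kernel and its dilates\<close>

text \<open>
  Dilating by \<open>t > 0\<close> turns the kernel into \<open>t\<^sup>-\<^sup>2 k(x / t, y / t, v / t)\<close>. The forms below
  describe this family by polynomials and a square root that make sense for \<open>t = 0\<close> too, where they
  give the homogeneous kernel at infinity. At \<open>t = 1\<close>, \<open>qform\<close> is \<open>(2 a sinh r)\<^sup>2\<close>, so that
  \<open>W = 1 / (2 \<pi> \<surd>q)\<close>; further \<open>X\<^sub>i q = - 2 g\<^sub>i\<close> and \<open>h\<^sub>i\<^sub>j = X\<^sub>i g\<^sub>j\<close>.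
\<close>

definition pform :: "real \<Rightarrow> pt \<Rightarrow> real" where
  "pform t = (\<lambda>(x, y, v). x\<^sup>2 + y\<^sup>2 + v\<^sup>2 + t\<^sup>2)"

definition qform :: "real \<Rightarrow> pt \<Rightarrow> real" where
  "qform t = (\<lambda>(x, y, v). (pform t (x, y, v))\<^sup>2 - 4 * t\<^sup>2 * v\<^sup>2)"

definition gform :: "nat \<Rightarrow> real \<Rightarrow> pt \<Rightarrow> real" where
  "gform i t = (\<lambda>(x, y, v).
     if i = 0 then - 2 * v\<^sup>2 * (pform t (x, y, v) - 2 * t\<^sup>2)
     else - 2 * (if i = 1 then x else y) * v * pform t (x, y, v))"

definition hform :: "nat \<Rightarrow> nat \<Rightarrow> real \<Rightarrow> pt \<Rightarrow> real" where
  "hform i j t = (\<lambda>(x, y, v).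
     if i = 0 then
       (if j = 0 then - 4 * v\<^sup>2 * (pform t (x, y, v) - 2 * t\<^sup>2) - 4 * v ^ 4
        else - 2 * (if j = 1 then x else y) * v * (pform t (x, y, v) + 2 * v\<^sup>2))
     else if j = 0 then - 4 * v ^ 3 * (if i = 1 then x else y)
     else - 4 * v\<^sup>2 * (if i = 1 then x else y) * (if j = 1 then x else y)
       - (if (i = 1) = (j = 1) then 2 * v\<^sup>2 * pform t (x, y, v) else 0))"

definition Riesz_form :: "nat \<Rightarrow> nat \<Rightarrow> real \<Rightarrow> pt \<Rightarrow> real" where
  "Riesz_form i j t z =
     (hform i j t z * qform t z + 3 * gform i t z * gform j t z)
       / (2 * pi * (qform t z)\<^sup>2 * sqrt (qform t z))"

lemma qform_pos:
  assumes "0 \<le> t" "t < v"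
  shows "qform t (x, y, v) > 0"
proof -
  have "qform t (x, y, v) = (x\<^sup>2 + y\<^sup>2 + (v - t)\<^sup>2) * (x\<^sup>2 + y\<^sup>2 + (v + t)\<^sup>2)"
    by (simp add: qform_def pform_def power2_eq_square algebra_simps)
  moreover have "x\<^sup>2 + y\<^sup>2 + (v - t)\<^sup>2 > 0" "x\<^sup>2 + y\<^sup>2 + (v + t)\<^sup>2 > 0"
    using assms by (auto intro!: add_nonneg_pos)
  ultimately show ?thesis by simp
qed

text \<open>
  All forms are homogeneous in \<open>(t, x, y, v)\<close> jointly: \<open>q\<close>, \<open>g\<close> and \<open>h\<close> of degree 4, hence
  the kernel of degree \<open>- 2\<close>.
\<close>

lemma Riesz_form_scale:
  assumes "c > 0"
  shows "Riesz_form i j (c * t) (c * x, c * y, c * v) = Riesz_form i j t (x, y, v) / c\<^sup>2"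
proof -
  have p: "pform (c * t) (c * x, c * y, c * v) = c\<^sup>2 * pform t (x, y, v)"
    by (simp add: pform_def power_mult_distrib algebra_simps)
  have q: "qform (c * t) (c * x, c * y, c * v) = c ^ 4 * qform t (x, y, v)"
    by (simp add: qform_def p power_mult_distrib algebra_simps flip: power_mult)
  have g: "gform i (c * t) (c * x, c * y, c * v) = c ^ 4 * gform i t (x, y, v)" for i
    by (simp add: gform_def p power_mult_distrib algebra_simps power2_eq_square power4_eq_xxxx)
  have h: "hform i j (c * t) (c * x, c * y, c * v) = c ^ 4 * hform i j t (x, y, v)"
    by (simp add: hform_def p power_mult_distrib algebra_simps power2_eq_square power4_eq_xxxx
        power3_eq_cube)
  have s: "sqrt (c ^ 4 * qform t (x, y, v)) = c\<^sup>2 * sqrt (qform t (x, y, v))"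
    using assms real_sqrt_unique[of "c\<^sup>2" "c ^ 4"] by (simp add: real_sqrt_mult)
  show ?thesis
    unfolding Riesz_form_def p q g h s using assms
    by (simp add: power_mult_distrib divide_simps power2_eq_square power4_eq_xxxx)
      (simp add: algebra_simps)
qed

text \<open>
  Both sides vanish at the identity, by division by zero, so the formula holds on the whole group.
\<close>

lemma Wker_eq:
  assumes "a > 0"
  shows "Wker (x, y, a) = 1 / (2 * pi * sqrt (qform 1 (x, y, a)))"
proof -
  have G: "(x, y, a) \<in> G" using assms by (simp add: G_def)
  define r where "r = hrad (x, y, a)"
  have c: "cosh r = pform 1 (x, y, a) / (2 * a)"
    unfolding r_def cosh_hrad(1)[OF G]
    using assms by (simp add: pform_def divide_simps power2_eq_square algebra_simps)
  have "(sinh r)\<^sup>2 = qform 1 (x, y, a) / (2 * a)\<^sup>2"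
    using assms by (simp add: sinh_square_eq c qform_def power_divide divide_simps)
  moreover have "sinh r \<ge> 0" using cosh_hrad(2)[OF G] by (simp add: r_def)
  ultimately have "sinh r = sqrt (qform 1 (x, y, a) / (2 * a)\<^sup>2)"
    by (metis real_sqrt_unique)
  then have s: "sinh r = sqrt (qform 1 (x, y, a)) / (2 * a)"
    using assms real_sqrt_abs[of "2 * a"] unfolding real_sqrt_divide by simp
  have m: "sqrt (modular (x, y, a)) = 1 / a"
    using assms by (simp add: modular_def power_int_minus real_sqrt_inverse real_sqrt_unique divide_inverse)
  show ?thesis unfolding Wker_def m r_def[symmetric] s using assms by (simp add: divide_simps)
qed

text \<open>
  The lines and coordinates along which the three fields differentiate, so that one computation serves
  every direction.
\<close>

definition axis_line :: "nat \<Rightarrow> pt \<Rightarrow> real \<Rightarrow> pt" where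
  "axis_line i = (\<lambda>(x, y, a) t. if i = 0 then (x, y, t) else if i = 1 then (t, y, a) else (x, t, a))"

definition axis_coord :: "nat \<Rightarrow> pt \<Rightarrow> real" where
  "axis_coord i = (\<lambda>(x, y, a). if i = 0 then a else if i = 1 then x else y)"

lemma axis_line_coord [simp]: "axis_line i z (axis_coord i z) = z"
  by (cases z) (auto simp: axis_line_def axis_coord_def)

lemma vfield_axis:
  "vfield i f z = snd (snd z) * deriv (\<lambda>t. f (axis_line i z t)) (axis_coord i z)"
  by (cases z) (simp add: vfield_def axis_line_def axis_coord_def)

lemma eventually_axis_line:
  assumes "snd (snd z) > c"
  shows "eventually (\<lambda>t. snd (snd (axis_line i z t)) > c) (nhds (axis_coord i z))"
proof -
  obtain x y a where z: "z = (x, y, a)" by (cases z)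
  have "eventually (\<lambda>t::real. t > c) (nhds a)"
    using assms z by (intro order_tendstoD[where y = a] tendsto_ident_at eventually_nhds_in_open)
      (auto simp: filterlim_ident)
  then show ?thesis using assms by (auto simp: z axis_line_def axis_coord_def)
qed

lemma qform_axis_deriv:
  assumes "snd (snd z) \<noteq> 0"
  shows "((\<lambda>s. qform t (axis_line i z s)) has_real_derivative - 2 * gform i t z / snd (snd z))
    (at (axis_coord i z))"
proof -
  obtain x y a where z: "z = (x, y, a)" by (cases z)
  show ?thesis using assms
    unfolding z qform_def gform_def axis_line_def axis_coord_def pform_def
    by (auto intro!: derivative_eq_intros simp: field_simps power2_eq_square)
qed

lemma gform_axis_deriv:
  assumes "snd (snd z) \<noteq> 0"
  shows "((\<lambda>s. gform j t (axis_line i z s)) has_real_derivative hform i j t z / snd (snd z))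
    (at (axis_coord i z))"
proof -
  obtain x y a where z: "z = (x, y, a)" by (cases z)
  show ?thesis using assms
    unfolding z hform_def gform_def axis_line_def axis_coord_def pform_def
    by (auto intro!: derivative_eq_intros
        simp: field_simps power2_eq_square power3_eq_cube power4_eq_xxxx)
qed

lemma DERIV_inverse_sqrt:
  assumes "(q has_real_derivative q') (at s)" "q s > 0"
  shows "((\<lambda>s. 1 / (2 * pi * sqrt (q s))) has_real_derivative
    - q' / (4 * pi * q s * sqrt (q s))) (at s)"
  using assms
  by (auto intro!: derivative_eq_intros DERIV_chain2[OF DERIV_real_sqrt assms(1)]
        simp: field_simps power2_eq_square)

lemma DERIV_over_sqrt_cubed:
  assumes "(q has_real_derivative q') (at s)" "(g has_real_derivative g') (at s)" "q s > 0"
  shows "((\<lambda>s. g s / (2 * pi * q s * sqrt (q s))) has_real_derivative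
    (g' * q s - 3 / 2 * g s * q') / (2 * pi * (q s)\<^sup>2 * sqrt (q s))) (at s)"
proof -
  define Q where "Q = q s"
  have Q: "Q > 0" using assms(3) by (simp add: Q_def)
  have "((\<lambda>s. g s / (2 * pi * q s * sqrt (q s))) has_real_derivative
     (g' * (2 * pi * q s * sqrt (q s)) - g s * (2 * pi * q' * sqrt (q s) +
           q' * (inverse (sqrt (q s)) / 2) * (2 * pi * q s)))
       / ((2 * pi * q s * sqrt (q s)) * (2 * pi * q s * sqrt (q s)))) (at s)"
    using assms(3)
    by (intro DERIV_divide DERIV_mult DERIV_cmult assms(1,2))
      (auto intro: DERIV_chain2[OF DERIV_real_sqrt assms(1), THEN DERIV_cong])
  moreover have "(g' * (2 * pi * Q * sqrt Q) - g s * (2 * pi * q' * sqrt Q +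
           q' * (inverse (sqrt Q) / 2) * (2 * pi * Q)))
       / ((2 * pi * Q * sqrt Q) * (2 * pi * Q * sqrt Q)) =
     (g' * Q - 3 / 2 * g s * q') / (2 * pi * Q\<^sup>2 * sqrt Q)"
  proof -
    obtain w where w: "w > 0" "Q = w * w" "sqrt Q = w"
      using Q by (metis real_sqrt_gt_zero real_sqrt_mult_self abs_of_pos)
    show ?thesis unfolding w(3) w(2) using w(1) by (simp add: field_simps power2_eq_square)
  qed
  ultimately show ?thesis by (simp add: Q_def)
qed

lemma vfield_Wker:
  assumes a: "snd (snd z) > 1"
  shows "vfield j Wker z = gform j 1 z / (2 * pi * qform 1 z * sqrt (qform 1 z))"
proof -
  let ?q = "\<lambda>s. qform 1 (axis_line j z s)"
  have q: "qform 1 z > 0" using a qform_pos[of 1 "snd (snd z)" "fst z" "fst (snd z)"] by simp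
  have ev: "eventually (\<lambda>s. Wker (axis_line j z s) = 1 / (2 * pi * sqrt (?q s)))
      (nhds (axis_coord j z))"
    using eventually_axis_line[OF a, of j]
    by eventually_elim (metis Wker_eq less_trans zero_less_one prod.collapse)
  have "((\<lambda>s. 1 / (2 * pi * sqrt (?q s))) has_real_derivative
      - (- 2 * gform j 1 z / snd (snd z)) / (4 * pi * qform 1 z * sqrt (qform 1 z)))
      (at (axis_coord j z))"
    using DERIV_inverse_sqrt[OF qform_axis_deriv[of z 1 j]] a q by simp
  then have "((\<lambda>s. 1 / (2 * pi * sqrt (?q s))) has_real_derivative
      gform j 1 z / (snd (snd z) * (2 * pi * qform 1 z * sqrt (qform 1 z)))) (at (axis_coord j z))"
    by (rule DERIV_cong) (use a q in \<open>simp add: divide_simps\<close>)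
  then have "deriv (\<lambda>s. Wker (axis_line j z s)) (axis_coord j z) =
      gform j 1 z / (snd (snd z) * (2 * pi * qform 1 z * sqrt (qform 1 z)))"
    using deriv_cong_ev[OF ev refl] DERIV_imp_deriv by metis
  then show ?thesis using a by (simp add: vfield_axis)
qed

lemma Riesz_kernel_eq:
  assumes a: "snd (snd z) > 1"
  shows "Riesz_kernel i j z = Riesz_form i j 1 z"
proof -
  let ?q = "\<lambda>s. qform 1 (axis_line i z s)" and ?g = "\<lambda>s. gform j 1 (axis_line i z s)"
  define Q where "Q = qform 1 z"
  have q: "Q > 0" unfolding Q_def
    using a qform_pos[of 1 "snd (snd z)" "fst z" "fst (snd z)"] by simp
  have ev: "eventually (\<lambda>s. vfield j Wker (axis_line i z s) = ?g s / (2 * pi * ?q s * sqrt (?q s)))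
      (nhds (axis_coord i z))"
    using eventually_axis_line[OF a, of i] by eventually_elim (rule vfield_Wker)
  have d: "((\<lambda>s. ?g s / (2 * pi * ?q s * sqrt (?q s))) has_real_derivative
      (hform i j 1 z / snd (snd z) * Q - 3 / 2 * gform j 1 z * (- 2 * gform i 1 z / snd (snd z)))
       / (2 * pi * Q\<^sup>2 * sqrt Q)) (at (axis_coord i z))"
    using DERIV_over_sqrt_cubed[OF qform_axis_deriv[of z 1 i] gform_axis_deriv[of z j 1 i]] a q
    unfolding Q_def by simp
  have "deriv (\<lambda>s. vfield j Wker (axis_line i z s)) (axis_coord i z) =
      (hform i j 1 z / snd (snd z) * Q - 3 / 2 * gform j 1 z * (- 2 * gform i 1 z / snd (snd z)))
       / (2 * pi * Q\<^sup>2 * sqrt Q)"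
    using deriv_cong_ev[OF ev refl] DERIV_imp_deriv[OF d] by metis
  also have "\<dots> = (hform i j 1 z * Q + 3 * gform i 1 z * gform j 1 z)
      / (snd (snd z) * (2 * pi * Q\<^sup>2 * sqrt Q))"
    using a q by (simp add: divide_simps)
  finally show ?thesis using a
    by (simp add: Riesz_kernel_def vfield_axis Riesz_form_def Q_def)
qed

lemma Riesz_form_isCont:
  assumes "qform t z > 0"
  shows "isCont (\<lambda>(t, z). Riesz_form i j t z) (t, z)"
proof -
  have p: "isCont (\<lambda>w::real \<times> pt. pform (fst w) (snd w)) w" for w
    unfolding pform_def case_prod_unfold by (intro continuous_intros)
  have q: "isCont (\<lambda>w::real \<times> pt. qform (fst w) (snd w)) w" for w
    unfolding qform_def case_prod_unfold using p by (auto intro!: continuous_intros)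
  have g: "isCont (\<lambda>w::real \<times> pt. gform i (fst w) (snd w)) w" for w i
    unfolding gform_def case_prod_unfold
    by (cases "i = 0"; cases "i = 1") (use p in \<open>auto intro!: continuous_intros\<close>)
  have h: "isCont (\<lambda>w::real \<times> pt. hform i j (fst w) (snd w)) w" for w
    unfolding hform_def case_prod_unfold
    by (cases "i = 0"; cases "i = 1"; cases "j = 0"; cases "j = 1")
      (use p in \<open>auto intro!: continuous_intros\<close>)
  show ?thesis
    unfolding Riesz_form_def case_prod_unfold
    using assms p q g h by (intro continuous_intros) auto
qed

text \<open>
  The two points are the horizontal offsets from the two poles of a dipole, seen from above at height 1.
\<close>

lemma Riesz_form_nonconstant:
  assumes "i \<in> {0, 1, 2}" "j \<in> {0, 1, 2}"
  shows "Riesz_form i j 0 (1, 1, 1) \<noteq> Riesz_form i j 0 (0, 0, 1)"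
proof -
  have "sqrt 9 = 3" by (simp add: real_sqrt_eq_iff)
  then show ?thesis
    using assms
    by (auto simp: Riesz_form_def hform_def gform_def qform_def pform_def field_simps)
qed

lemma borel_measurable_Riesz_form [measurable]:
  "Riesz_form i j t \<in> borel_measurable (borel \<Otimes>\<^sub>M borel \<Otimes>\<^sub>M borel)"
  unfolding Riesz_form_def hform_def gform_def qform_def pform_def by measurable


section \<open>Random signs\<close>

definition rsign :: "'a set \<Rightarrow> 'a \<Rightarrow> complex" where
  "rsign A j = (if j \<in> A then 1 else - 1)"

lemma norm_rsign [simp]: "norm (rsign A j) = 1"
  by (simp add: rsign_def)

text \<open>
  For independent signs the factor at \<open>j0\<close>, with the extra sign, has average \<open>w\<^sub>j\<^sub>0\<close>, and every
  other factor has average 1. The sum over sign patterns is the expansion over subsets of a product of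
  terms \<open>(1 + w\<^sub>j) + (1 - w\<^sub>j)\<close>, with a minus sign in the middle for \<open>j = j0\<close>.
\<close>

lemma sum_rsign_prod:
  assumes "finite J" "j0 \<in> J"
  shows "(\<Sum>A\<in>Pow J. rsign A j0 * (\<Prod>j\<in>J. 1 + rsign A j * w j)) = 2 ^ card J * w j0"
proof -
  \<comment> \<open>The factor at \<open>j\<close> for either sign, multiplied at \<open>j0\<close> by that sign.\<close>
  define f1 where "f1 j = 1 + w j" for j
  define f2 where "f2 j = (if j = j0 then - 1 else 1) * (1 - w j)" for j
  have "rsign A j0 * (\<Prod>j\<in>J. 1 + rsign A j * w j) = (\<Prod>j\<in>A. f1 j) * (\<Prod>j\<in>J - A. f2 j)"
    if "A \<in> Pow J" for A
  proof -
    have "rsign A j0 = (\<Prod>j\<in>J. if j = j0 then rsign A j0 else 1)"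
      using assms by (simp add: prod.delta)
    then have "rsign A j0 * (\<Prod>j\<in>J. 1 + rsign A j * w j) =
        (\<Prod>j\<in>J. (if j = j0 then rsign A j0 else 1) * (1 + rsign A j * w j))"
      by (simp only: prod.distrib)
    also have "\<dots> = (\<Prod>j\<in>J - A. (if j = j0 then rsign A j0 else 1) * (1 + rsign A j * w j)) *
        (\<Prod>j\<in>A. (if j = j0 then rsign A j0 else 1) * (1 + rsign A j * w j))"
      using that assms(1) by (intro prod.subset_diff) auto
    also have "\<dots> = (\<Prod>j\<in>J - A. f2 j) * (\<Prod>j\<in>A. f1 j)"
      by (intro arg_cong2[where f = "(*)"] prod.cong) (auto simp: rsign_def f1_def f2_def)
    finally show ?thesis by (simp add: mult.commute)
  qed
  then have "(\<Sum>A\<in>Pow J. rsign A j0 * (\<Prod>j\<in>J. 1 + rsign A j * w j)) = (\<Prod>j\<in>J. f1 j + f2 j)"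
    using prod_add[OF assms(1), of f1 f2] by simp
  also have "\<dots> = (\<Prod>j\<in>J. 2 * (if j = j0 then w j0 else 1))"
    by (intro prod.cong) (auto simp: f1_def f2_def)
  also have "\<dots> = 2 ^ card J * w j0"
    unfolding prod.distrib using assms by (simp add: prod.delta)
  finally show ?thesis .
qed

text \<open>
  The imaginary unit makes each factor have modulus \<open>\<surd>(1 + \<epsilon>\<^sup>2 \<phi>\<^sup>2)\<close>, a second-order quantity; a
  product with real factors can reach the size of \<open>exp (\<epsilon> \<Sum> \<bar>\<phi>\<bar>)\<close>.
\<close>

lemma norm_prod_rsign_le:
  fixes \<phi> :: "'a \<Rightarrow> real"
  assumes "(\<Sum>j\<in>J. (\<phi> j)\<^sup>2) \<le> N"
  shows "norm (\<Prod>j\<in>J. 1 + rsign A j * (\<i> * of_real (\<epsilon> * \<phi> j))) \<le> exp (\<epsilon>\<^sup>2 * N / 2)"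
proof -
  have "norm (1 + rsign A j * (\<i> * of_real (\<epsilon> * \<phi> j))) \<le> exp (\<epsilon>\<^sup>2 * (\<phi> j)\<^sup>2 / 2)" for j
  proof -
    have "norm (1 + rsign A j * (\<i> * of_real (\<epsilon> * \<phi> j))) = sqrt (1 + (\<epsilon> * \<phi> j)\<^sup>2)"
      by (simp add: rsign_def cmod_def)
    also have "\<dots> \<le> exp (\<epsilon>\<^sup>2 * (\<phi> j)\<^sup>2 / 2)"
    proof (rule real_le_lsqrt)
      have "1 + (\<epsilon> * \<phi> j)\<^sup>2 \<le> exp ((\<epsilon> * \<phi> j)\<^sup>2)" by (rule exp_ge_add_one_self)
      also have "\<dots> = (exp (\<epsilon>\<^sup>2 * (\<phi> j)\<^sup>2 / 2))\<^sup>2"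
        by (simp add: power_mult_distrib flip: exp_double)
      finally show "1 + (\<epsilon> * \<phi> j)\<^sup>2 \<le> (exp (\<epsilon>\<^sup>2 * (\<phi> j)\<^sup>2 / 2))\<^sup>2" .
    qed simp
    finally show ?thesis .
  qed
  then have "norm (\<Prod>j\<in>J. 1 + rsign A j * (\<i> * of_real (\<epsilon> * \<phi> j)))
      \<le> (\<Prod>j\<in>J. exp (\<epsilon>\<^sup>2 * (\<phi> j)\<^sup>2 / 2))"
    unfolding prod_norm[symmetric] by (intro prod_mono) auto
  also have "\<dots> = exp (\<epsilon>\<^sup>2 / 2 * (\<Sum>j\<in>J. (\<phi> j)\<^sup>2))"
  proof (cases "finite J")
    case True
    then have "(\<Prod>j\<in>J. exp (\<epsilon>\<^sup>2 * (\<phi> j)\<^sup>2 / 2)) = exp (\<Sum>j\<in>J. \<epsilon>\<^sup>2 * (\<phi> j)\<^sup>2 / 2)"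
      by (rule exp_sum[symmetric])
    also have "(\<Sum>j\<in>J. \<epsilon>\<^sup>2 * (\<phi> j)\<^sup>2 / 2) = \<epsilon>\<^sup>2 / 2 * (\<Sum>j\<in>J. (\<phi> j)\<^sup>2)"
      unfolding sum_distrib_left by (intro sum.cong) auto
    finally show ?thesis .
  qed simp
  also have "\<dots> \<le> exp (\<epsilon>\<^sup>2 / 2 * N)"
    using assms by (simp add: mult_left_mono)
  finally show ?thesis by simp
qed

lemma sum_le_one_if_at_most_one:
  fixes f :: "'a \<Rightarrow> real"
  assumes "\<And>a b. a \<in> S \<Longrightarrow> b \<in> S \<Longrightarrow> f a \<noteq> 0 \<Longrightarrow> f b \<noteq> 0 \<Longrightarrow> a = b"
    and "\<And>a. a \<in> S \<Longrightarrow> f a \<le> 1"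
  shows "sum f S \<le> 1"
proof (cases "finite S \<and> (\<exists>a\<in>S. f a \<noteq> 0)")
  case True
  then obtain a where a: "a \<in> S" "f a \<noteq> 0" by blast
  have "sum f (S - {a}) = 0" by (rule sum.neutral) (use assms(1)[OF a(1)] a in blast)
  then have "sum f S = f a" using True a by (simp add: sum.remove[of S a])
  then show ?thesis using assms(2) a by simp
next
  case False
  then have "sum f S = 0" by (metis sum.infinite sum.neutral)
  then show ?thesis by simp
qed


section \<open>Multi-scale test functions\<close>

text \<open>
  \<open>P\<close> is a one-dimensional cutoff from which all test functions are built. The bumps have relative
  width \<open>\<theta>\<close>, small enough to keep the dipoles of different cells apart. The smallest cells have size
  of order \<open>T 2\<^sup>n\<close>, the supports reach up to height of order \<open>2\<^sup>n\<close>, and a large ratio \<open>T\<close> brings the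
  kernel close to the homogeneous one.
\<close>

locale test_atoms =
  fixes P :: "real \<Rightarrow> real" and T \<theta> :: real and n :: nat
  assumes P_cont: "continuous_on UNIV P"
    and P_range: "0 \<le> P s" "P s \<le> 1"
    and P_one: "\<bar>s\<bar> \<le> 1 \<Longrightarrow> P s = 1"
    and P_zero: "5/2 \<le> \<bar>s\<bar> \<Longrightarrow> P s = 0"
    and T_ge: "T \<ge> 25" and \<theta>_bounds: "0 < \<theta>" "\<theta> \<le> 1/8" and n_ge: "n \<ge> 2"
begin

text \<open>
  Cells at scale \<open>k\<close> have side \<open>2 * mesh k\<close>. The function \<open>height\<close> cuts off heights
  outside about \<open>[2\<^sup>-\<^sup>n, 2\<^sup>n]\<close>: the first term cuts at the top, the second at the bottom.
\<close>

definition mesh :: "nat \<Rightarrow> real" where "mesh k = T * 2 ^ (n + k)"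
definition plateau :: "real \<Rightarrow> real" where "plateau s = P (s / (2 * T * 4 ^ n))"
definition height :: "real \<Rightarrow> real" where "height c = P (c / 2 ^ n) - P (c * 2 ^ n)"
definition bump :: "real \<Rightarrow> real \<Rightarrow> real \<Rightarrow> pt \<Rightarrow> real" where
  "bump h o1 o2 z = P ((fst z - o1) / h) * P ((fst (snd z) - o2) / h)"

definition bump0 :: "nat \<times> nat \<times> nat \<Rightarrow> pt \<Rightarrow> real" where
  "bump0 = (\<lambda>(k, l1, l2). bump (\<theta> * mesh k) (2 * l1 * mesh k) (2 * l2 * mesh k))"
definition bump1 :: "nat \<times> nat \<times> nat \<Rightarrow> pt \<Rightarrow> real" where
  "bump1 = (\<lambda>(k, l1, l2). bump (\<theta> * mesh k) ((2 * l1 + 1) * mesh k) ((2 * l2 + 1) * mesh k))"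
text \<open>
  The vanishing integral of a dipole is what leaves the sign average undisturbed by the subtraction of
  the means; the difference of its poles is what the kernel detects.
\<close>

definition dipole :: "nat \<times> nat \<times> nat \<Rightarrow> pt \<Rightarrow> real" where
  "dipole j z = bump0 j z - bump1 j z"

text \<open>
  At scale \<open>k\<close> there are \<open>4\<^bsup>n-k\<^esup>\<close> cells, so that the cells of each scale fill the same square
  of side \<open>2 T 4\<^sup>n\<close>.
\<close>

definition cells :: "(nat \<times> nat \<times> nat) set" where
  "cells = (SIGMA k:{..<n}. {..<2 ^ (n - k)} \<times> {..<2 ^ (n - k)})"

definition weight :: "pt \<Rightarrow> real" where
  "weight z = height (snd (snd z)) * (plateau (fst z) * plateau (fst (snd z)))"

definition signed_prod :: "(nat \<times> nat \<times> nat) set \<Rightarrow> pt \<Rightarrow> complex" where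
  "signed_prod A z = (\<Prod>j\<in>cells. 1 + rsign A j * (\<i> * of_real (1 / sqrt n * dipole j z)))"

definition mean :: "(nat \<times> nat \<times> nat) set \<Rightarrow> complex" where
  "mean A = (\<integral>z. of_real (weight z) * signed_prod A z \<partial>haar) / of_real (\<integral>z. weight z \<partial>haar)"

definition test_fun :: "(nat \<times> nat \<times> nat) set \<Rightarrow> pt \<Rightarrow> complex" where
  "test_fun A z = of_real (weight z) * (signed_prod A z - mean A)"

definition supp_box :: "pt set" where
  "supp_box = {- (5 * T * 4 ^ n)..5 * T * 4 ^ n} \<times> {- (5 * T * 4 ^ n)..5 * T * 4 ^ n} \<times>
     {1 / 2 ^ n..5/2 * 2 ^ n}"

lemma finite_cells [simp]: "finite cells"
  by (auto simp: cells_def)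

lemma mesh_pos [simp]: "mesh k > 0"
  using T_ge by (simp add: mesh_def)

lemma mesh_nonzero [simp]: "mesh k \<noteq> 0"
  using mesh_pos[of k] by (simp del: mesh_pos)

lemma P_meas [measurable]: "P \<in> borel_measurable borel"
  using P_cont by (rule borel_measurable_continuous_onI)

lemma height_meas [measurable]: "height \<in> borel_measurable borel"
  unfolding height_def by measurable

lemma bump_meas [measurable]: "bump h o1 o2 \<in> borel_measurable (borel \<Otimes>\<^sub>M borel \<Otimes>\<^sub>M borel)"
  unfolding bump_def by measurable

lemma dipole_meas [measurable]: "dipole j \<in> borel_measurable (borel \<Otimes>\<^sub>M borel \<Otimes>\<^sub>M borel)"
  unfolding dipole_def bump0_def bump1_def by (cases j) simp

lemma weight_meas [measurable]: "weight \<in> borel_measurable (borel \<Otimes>\<^sub>M borel \<Otimes>\<^sub>M borel)"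
  unfolding weight_def plateau_def by measurable

lemma signed_prod_meas [measurable]:
  "signed_prod A \<in> borel_measurable (borel \<Otimes>\<^sub>M borel \<Otimes>\<^sub>M borel)"
  unfolding signed_prod_def by measurable

lemma test_fun_meas [measurable]: "test_fun A \<in> borel_measurable (borel \<Otimes>\<^sub>M borel \<Otimes>\<^sub>M borel)"
  unfolding test_fun_def by measurable

lemma two_le_pow: "4 \<le> (2::real) ^ n"
  using power_increasing[OF n_ge, of "2::real"] by simp

lemma height_range:
  assumes "c > 0"
  shows "0 \<le> height c" "height c \<le> 1"
proof -
  have "P (c * 2 ^ n) \<le> P (c / 2 ^ n)"
  proof (cases "c \<le> 2 ^ n")
    case True
    then show ?thesis using P_one[of "c / 2 ^ n"] P_range assms by simp
  next
    case False
    have "2 ^ n * 2 ^ n \<ge> (4 * 4 :: real)" using two_le_pow by (intro mult_mono) auto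
    also have "2 ^ n * 2 ^ n \<le> c * 2 ^ n" using False by (intro mult_right_mono) auto
    finally show ?thesis using P_zero[of "c * 2 ^ n"] P_range assms by simp
  qed
  then show "0 \<le> height c" "height c \<le> 1"
    using P_range(2)[of "c / 2 ^ n"] P_range(1)[of "c * 2 ^ n"] by (auto simp: height_def)
qed

lemma height_supp:
  assumes "c > 0" "height c \<noteq> 0"
  shows "1 / 2 ^ n \<le> c" "c \<le> 5/2 * 2 ^ n"
proof -
  have pos: "(2::real) ^ n > 0" by simp
  show "1 / 2 ^ n \<le> c"
  proof (rule ccontr)
    assume c: "\<not> 1 / 2 ^ n \<le> c"
    then have 1: "c * 2 ^ n \<le> 1" using pos by (simp add: field_simps)
    have "c \<le> 1 / 2 ^ n" using c by simp
    also have "\<dots> \<le> 1" by simp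
    also have "1 \<le> (2::real) ^ n" by simp
    finally have "c / 2 ^ n \<le> 1" using pos by (simp add: field_simps)
    then have "height c = 0" using 1 assms(1) by (simp add: height_def P_one)
    then show False using assms by simp
  qed
  show "c \<le> 5/2 * 2 ^ n"
  proof (rule ccontr)
    assume "\<not> c \<le> 5/2 * 2 ^ n"
    then have c: "c > 5/2 * 2 ^ n" by simp
    then have 1: "c / 2 ^ n \<ge> 5/2" using pos by (simp add: field_simps)
    have "c * 1 \<le> c * 2 ^ n" using assms by (intro mult_left_mono) auto
    then have 2: "c * 2 ^ n \<ge> 5/2" using c two_le_pow by linarith
    have "height c = 0" using 1 2 assms(1) by (simp add: height_def P_zero)
    then show False using assms by simp
  qed
qed

lemma height_one:
  assumes "5/2 / 2 ^ n \<le> c" "c \<le> 2 ^ n"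
  shows "height c = 1"
proof -
  have pos: "(2::real) ^ n > 0" by simp
  have "c > 0" using assms(1) pos by (smt (verit) divide_pos_pos)
  moreover have "c * 2 ^ n \<ge> 5/2" using assms(1) pos by (simp add: field_simps)
  ultimately show ?thesis using assms(2) by (simp add: height_def P_one P_zero)
qed

lemma plateau_range: "0 \<le> plateau s" "plateau s \<le> 1"
  by (auto simp: plateau_def P_range)

lemma plateau_one: "\<bar>s\<bar> \<le> 2 * T * 4 ^ n \<Longrightarrow> plateau s = 1"
  using T_ge by (auto simp: plateau_def intro!: P_one)

lemma plateau_supp:
  assumes "plateau s \<noteq> 0" shows "\<bar>s\<bar> \<le> 5 * T * 4 ^ n"
proof (rule ccontr)
  assume "\<not> ?thesis"
  then have "5/2 \<le> \<bar>s / (2 * T * 4 ^ n)\<bar>" using T_ge by (simp add: field_simps)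
  then show False using assms P_zero by (simp add: plateau_def)
qed

lemma weight_range: "snd (snd z) > 0 \<Longrightarrow> 0 \<le> weight z" "snd (snd z) > 0 \<Longrightarrow> weight z \<le> 1"
  using height_range[of "snd (snd z)"] plateau_range unfolding weight_def
  by (auto intro!: mult_nonneg_nonneg mult_le_one)

lemma weight_supp: "snd (snd z) > 0 \<Longrightarrow> weight z \<noteq> 0 \<Longrightarrow> z \<in> supp_box"
  using height_supp[of "snd (snd z)"] plateau_supp[of "fst z"] plateau_supp[of "fst (snd z)"]
  by (cases z) (auto simp: weight_def supp_box_def)

lemma bump_range: "0 \<le> bump h o1 o2 z" "bump h o1 o2 z \<le> 1"
  unfolding bump_def using P_range by (auto intro!: mult_nonneg_nonneg mult_le_one)

lemma bump_supp:
  assumes "bump h o1 o2 z \<noteq> 0" "h > 0"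
  shows "\<bar>fst z - o1\<bar> \<le> 5/2 * h" "\<bar>fst (snd z) - o2\<bar> \<le> 5/2 * h"
proof -
  have "\<bar>(fst z - o1) / h\<bar> < 5/2" "\<bar>(fst (snd z) - o2) / h\<bar> < 5/2"
    using assms(1) P_zero unfolding bump_def by (smt (verit) mult_eq_0_iff)+
  then show "\<bar>fst z - o1\<bar> \<le> 5/2 * h" "\<bar>fst (snd z) - o2\<bar> \<le> 5/2 * h"
    using assms(2) by (simp_all add: field_simps)
qed

lemma dipole_bound: "\<bar>dipole j z\<bar> \<le> 1"
  unfolding dipole_def bump0_def bump1_def using bump_range by (cases j) (simp add: abs_le_iff, smt (verit))

lemma near_multiple:
  assumes "\<bar>s - c * U\<bar> \<le> 5/2 * (\<theta> * U)" "U > 0"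
  shows "\<bar>s / U - c\<bar> \<le> 5/16"
proof -
  have "\<theta> * U \<le> 1/8 * U" using \<theta>_bounds assms by (intro mult_right_mono) auto
  then have "\<bar>s - c * U\<bar> \<le> 5/16 * U" using assms by linarith
  then have "\<bar>s - c * U\<bar> / U \<le> 5/16" using assms(2) by (simp add: divide_le_eq)
  moreover have "s / U - c = (s - c * U) / U" using assms(2) by (simp add: field_simps)
  ultimately show ?thesis using assms(2) by simp
qed

lemma dipole_supp:
  assumes "dipole (k, l1, l2) z \<noteq> 0"
  shows "2 * real l1 - 5/16 \<le> fst z / mesh k" "fst z / mesh k \<le> 2 * real l1 + 21/16"
    "2 * real l2 - 5/16 \<le> fst (snd z) / mesh k" "fst (snd z) / mesh k \<le> 2 * real l2 + 21/16"
proof -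
  let ?U = "mesh k"
  have h: "\<theta> * ?U > 0" using \<theta>_bounds by simp
  have U: "?U > 0" by simp
  have b: "bump0 (k, l1, l2) z \<noteq> 0 \<or> bump1 (k, l1, l2) z \<noteq> 0" using assms by (auto simp: dipole_def)
  have "2 * real l1 - 5/16 \<le> fst z / ?U \<and> fst z / ?U \<le> 2 * real l1 + 21/16 \<and>
    2 * real l2 - 5/16 \<le> fst (snd z) / ?U \<and> fst (snd z) / ?U \<le> 2 * real l2 + 21/16"
    using b
  proof
    assume "bump0 (k, l1, l2) z \<noteq> 0"
    then have "bump (\<theta> * ?U) (2 * real l1 * ?U) (2 * real l2 * ?U) z \<noteq> 0" by (simp add: bump0_def)
    from bump_supp[OF this h] show ?thesis
      using near_multiple[OF _ U, of "fst z" "2 * real l1"]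
        near_multiple[OF _ U, of "fst (snd z)" "2 * real l2"] U unfolding abs_le_iff by linarith
  next
    assume "bump1 (k, l1, l2) z \<noteq> 0"
    then have "bump (\<theta> * ?U) ((2 * real l1 + 1) * ?U) ((2 * real l2 + 1) * ?U) z \<noteq> 0"
      by (simp add: bump1_def)
    from bump_supp[OF this h] show ?thesis
      using near_multiple[OF _ U, of "fst z" "2 * real l1 + 1"]
        near_multiple[OF _ U, of "fst (snd z)" "2 * real l2 + 1"] U unfolding abs_le_iff by linarith
  qed
  then show "2 * real l1 - 5/16 \<le> fst z / ?U" "fst z / ?U \<le> 2 * real l1 + 21/16"
    "2 * real l2 - 5/16 \<le> fst (snd z) / ?U" "fst (snd z) / ?U \<le> 2 * real l2 + 21/16" by auto
qed

lemma mesh_cells: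
  assumes "k < n" shows "mesh k * (2 * 2 ^ (n - k)) = 2 * T * 4 ^ n"
proof -
  have "(2::real) ^ (n + k) * 2 ^ (n - k) = 2 ^ (n + n)"
    using assms by (simp flip: power_add)
  also have "\<dots> = 4 ^ n" by (simp add: power_add flip: power_mult_distrib)
  finally show ?thesis by (simp add: mesh_def)
qed

lemma cell_coordinate_bound:
  assumes "k < n" "l < 2 ^ (n - k)" "2 * real l - 5/16 \<le> s / mesh k" "s / mesh k \<le> 2 * real l + 21/16"
  shows "\<bar>s\<bar> \<le> 2 * T * 4 ^ n"
proof -
  have "real l + 1 \<le> 2 ^ (n - k)" using assms(2) by (metis Suc_leI of_nat_Suc of_nat_le_iff of_nat_numeral of_nat_power add.commute)
  moreover have "1 \<le> (2::real) ^ (n - k)" by simp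
  ultimately have "\<bar>s / mesh k\<bar> \<le> 2 * 2 ^ (n - k)" using assms(3,4) by linarith
  then have "\<bar>s\<bar> \<le> mesh k * (2 * 2 ^ (n - k))"
    using mesh_pos[of k] by (simp add: field_simps del: mesh_pos)
  then show ?thesis using mesh_cells[OF assms(1)] by simp
qed

lemma weight_dipole:
  assumes "j \<in> cells"
  shows "weight z * dipole j z = height (snd (snd z)) * dipole j z"
proof (cases "dipole j z = 0")
  case False
  obtain k l1 l2 where j: "j = (k, l1, l2)" by (cases j)
  have "k < n" "l1 < 2 ^ (n - k)" "l2 < 2 ^ (n - k)" using assms by (auto simp: j cells_def)
  then have "\<bar>fst z\<bar> \<le> 2 * T * 4 ^ n" "\<bar>fst (snd z)\<bar> \<le> 2 * T * 4 ^ n"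
    using dipole_supp[OF False[unfolded j]] cell_coordinate_bound by blast+
  then show ?thesis by (simp add: weight_def plateau_one)
qed simp

text \<open>
  Dipoles of one scale have disjoint supports, so each scale contributes at most 1.
\<close>

lemma sum_dipole_squares: "(\<Sum>j\<in>cells. (dipole j z)\<^sup>2) \<le> n"
proof -
  have "(\<Sum>l\<in>{..<2 ^ (n - k)} \<times> {..<2 ^ (n - k)}. (dipole (k, l) z)\<^sup>2) \<le> 1" for k
  proof (rule sum_le_one_if_at_most_one)
    fix a b assume "(dipole (k, a) z)\<^sup>2 \<noteq> 0" "(dipole (k, b) z)\<^sup>2 \<noteq> 0"
    then have d: "dipole (k, fst a, snd a) z \<noteq> 0" "dipole (k, fst b, snd b) z \<noteq> 0" by auto
    have "\<bar>2 * real (fst a) - 2 * real (fst b)\<bar> < 2" "\<bar>2 * real (snd a) - 2 * real (snd b)\<bar> < 2"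
      using dipole_supp[OF d(1)] dipole_supp[OF d(2)] by linarith+
    then show "a = b" by (simp add: prod_eq_iff) linarith
  next
    fix a show "(dipole (k, a) z)\<^sup>2 \<le> 1"
      using dipole_bound[of "(k, a)" z] by (simp add: abs_square_le_1)
  qed
  then have "(\<Sum>k<n. \<Sum>l\<in>{..<2 ^ (n - k)} \<times> {..<2 ^ (n - k)}. (dipole (k, l) z)\<^sup>2) \<le> (\<Sum>k<n. 1)"
    by (intro sum_mono)
  moreover have "(\<Sum>j\<in>cells. (dipole j z)\<^sup>2) =
      (\<Sum>k<n. \<Sum>l\<in>{..<2 ^ (n - k)} \<times> {..<2 ^ (n - k)}. (dipole (k, l) z)\<^sup>2)"
    unfolding cells_def
    using sum.Sigma[of "{..<n}" "\<lambda>k. {..<2 ^ (n - k)} \<times> {..<2 ^ (n - k)}"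
        "\<lambda>k l. (dipole (k, l) z)\<^sup>2"] by simp
  ultimately show ?thesis by simp
qed

lemma norm_signed_prod: "norm (signed_prod A z) \<le> 2"
proof -
  have "norm (signed_prod A z) \<le> exp ((1 / sqrt n)\<^sup>2 * n / 2)"
    unfolding signed_prod_def by (rule norm_prod_rsign_le[OF sum_dipole_squares])
  also have "(1 / sqrt n)\<^sup>2 * n / 2 = 1 / 2" using n_ge by (simp add: power_divide)
  also have "exp (1 / 2 :: real) \<le> 2"
  proof -
    have "(exp (1 / 2 :: real))\<^sup>2 \<le> 2\<^sup>2" using exp_le by (simp flip: exp_double)
    then show ?thesis by (rule power2_le_imp_le) simp
  qed
  finally show ?thesis .
qed

end

lemma borel_measurable_ptI:
  "f \<in> borel_measurable (borel \<Otimes>\<^sub>M borel \<Otimes>\<^sub>M borel) \<Longrightarrow> (f :: pt \<Rightarrow> 'b::topological_space) \<in> borel_measurable borel"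
  by (simp add: borel_prod)

context test_atoms begin

lemma G_height: "z \<in> G \<longleftrightarrow> snd (snd z) > 0"
  by (cases z) (simp add: G_def)

lemma pos_if_ge: "1 / 2 ^ n \<le> b \<Longrightarrow> b > (0::real)"
  by (rule less_le_trans[of 0 "1 / 2 ^ n"]) simp_all

lemma weight_zero: "z \<in> G \<Longrightarrow> z \<notin> supp_box \<Longrightarrow> weight z = 0"
  using weight_supp G_height by blast

lemma integrable_supp_box:
  fixes F :: "pt \<Rightarrow> 'b::{banach, second_countable_topology}"
  assumes "F \<in> borel_measurable (borel \<Otimes>\<^sub>M borel \<Otimes>\<^sub>M borel)"
    and "\<And>z. z \<in> G \<Longrightarrow> norm (F z) \<le> M"
    and "\<And>z. z \<in> G \<Longrightarrow> z \<notin> supp_box \<Longrightarrow> F z = 0"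
  shows "integrable haar F"
proof (rule integrable_haar_bounded[OF borel_measurable_ptI[OF assms(1)]])
  show "(0::real) < 1 / 2 ^ n" by simp
  show "norm (F z) \<le> M" if "z \<in> {- (5 * T * 4 ^ n)..5 * T * 4 ^ n} \<times>
      {- (5 * T * 4 ^ n)..5 * T * 4 ^ n} \<times> {1 / 2 ^ n..5/2 * 2 ^ n}" for z
  proof -
    have "z \<in> G" using that pos_if_ge by (cases z) (simp add: G_def)
    then show ?thesis by (rule assms(2))
  qed
qed (use assms(3) in \<open>simp add: supp_box_def\<close>)

lemma integrable_weight: "integrable haar weight"
proof (rule integrable_supp_box[where M = 1])
  show "norm (weight z) \<le> 1" if "z \<in> G" for z
    using that weight_range[of z] by (simp add: G_height)
qed (use weight_zero in simp_all)

lemma integrable_weight_prod: "integrable haar (\<lambda>z. of_real (weight z) * signed_prod A z)"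
proof (rule integrable_supp_box[where M = 2])
  fix z assume "z \<in> G"
  then have "\<bar>weight z\<bar> * norm (signed_prod A z) \<le> 1 * 2"
    using weight_range[of z] norm_signed_prod by (intro mult_mono) (auto simp: G_height)
  then show "norm (of_real (weight z) * signed_prod A z) \<le> 2"
    by (simp add: norm_mult)
next
  fix z assume "z \<in> G" "z \<notin> supp_box"
  then show "of_real (weight z) * signed_prod A z = 0"
    by (simp add: weight_zero)
qed measurable

lemma integral_weight_pos: "(\<integral>z. weight z \<partial>haar) > 0"
proof -
  let ?X = "{-1..1} \<times> {-1..1} \<times> {1..2} :: pt set"
  have e: "emeasure haar ?X = ennreal (4 * ln 2)"
    by (subst emeasure_haar_box) auto
  have X: "?X \<in> sets haar" by (rule box_sets_haar) simp
  have "1 * 1 \<le> T * 4 ^ n" using T_ge by (intro mult_mono) auto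
  then have L: "1 \<le> 2 * T * 4 ^ n" by simp
  have pl: "plateau s = 1" if "\<bar>s\<bar> \<le> 1" for s
    using that L by (intro plateau_one) linarith
  have "5/2 / 2 ^ n \<le> (1::real)" using two_le_pow by (simp add: divide_le_eq)
  then have he: "height c = 1" if "1 \<le> c" "c \<le> 2" for c
    using that two_le_pow by (intro height_one) linarith+
  have "indicator ?X z \<le> weight z" if "z \<in> G" for z
  proof (cases "z \<in> ?X")
    case True
    then have "weight z = 1" by (cases z) (simp add: weight_def pl he abs_le_iff)
    then show ?thesis by simp
  next
    case False
    then show ?thesis using weight_range(1)[of z] that by (simp add: G_height)
  qed
  moreover have "integrable haar (indicator ?X :: pt \<Rightarrow> real)"
    by (rule integrable_real_indicator[OF X]) (simp add: e)
  ultimately have "(\<integral>z. indicator ?X z \<partial>haar) \<le> (\<integral>z. weight z \<partial>haar)"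
    by (intro integral_mono integrable_weight) auto
  moreover have "(\<integral>z. indicator ?X z \<partial>haar) = (4 * ln 2 :: real)"
  proof -
    have "?X \<inter> space haar = ?X" using sets.sets_into_space[OF X] by blast
    then show ?thesis using e by (simp add: measure_def)
  qed
  ultimately show ?thesis by (smt (verit) ln_gt_zero)
qed

lemma norm_mean: "norm (mean A) \<le> 2"
proof -
  have "norm (\<integral>z. of_real (weight z) * signed_prod A z \<partial>haar) \<le> (\<integral>z. 2 * weight z \<partial>haar)"
  proof (rule Bochner_Integration.integral_norm_bound_integral[OF integrable_weight_prod])
    fix z assume "z \<in> space haar"
    then show "norm (of_real (weight z) * signed_prod A z) \<le> 2 * weight z"
      using weight_range[of z] norm_signed_prod[of A z]
      using mult_left_mono[of "norm (signed_prod A z)" 2 "weight z"]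
      by (simp add: G_height norm_mult mult.commute)
  qed (intro integrable_mult_right integrable_weight)
  then show ?thesis
    using integral_weight_pos by (simp add: mean_def norm_divide divide_le_eq)
qed

lemma norm_test_fun: "z \<in> G \<Longrightarrow> norm (test_fun A z) \<le> 4"
proof -
  assume z: "z \<in> G"
  have "norm (signed_prod A z - mean A) \<le> 4"
    using norm_triangle_ineq4[of "signed_prod A z" "mean A"] norm_signed_prod[of A z] norm_mean[of A]
    by linarith
  then have "\<bar>weight z\<bar> * norm (signed_prod A z - mean A) \<le> 1 * 4"
    using weight_range[of z] z by (intro mult_mono) (auto simp: G_height)
  then show ?thesis by (simp add: test_fun_def norm_mult)
qed

lemma test_fun_supp: "z \<in> G \<Longrightarrow> z \<notin> supp_box \<Longrightarrow> test_fun A z = 0"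
  by (simp add: test_fun_def weight_zero)

lemma integrable_test_fun: "integrable haar (test_fun A)"
  by (rule integrable_supp_box[where M = 4]) (use norm_test_fun test_fun_supp in auto)

lemma integral_test_fun: "(\<integral>z. test_fun A z \<partial>haar) = 0"
proof -
  have "integrable haar (\<lambda>z. complex_of_real (weight z) * mean A)"
    using integrable_of_real[OF integrable_weight, where 'a = complex] by (intro integrable_mult_left) simp
  then have "(\<integral>z. test_fun A z \<partial>haar) =
      (\<integral>z. of_real (weight z) * signed_prod A z \<partial>haar) - (\<integral>z. of_real (weight z) * mean A \<partial>haar)"
    unfolding test_fun_def right_diff_distrib using integrable_weight_prod by (intro Bochner_Integration.integral_diff)
  also have "\<dots> = 0"
    using integral_weight_pos by (simp add: mean_def)
  finally show ?thesis .
qed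

lemma integrable_height_bump:
  assumes "h > 0"
  shows "integrable haar (\<lambda>z. height (snd (snd z)) * bump h o1 o2 z)"
proof (rule integrable_haar_bounded[where M = 1])
  show "(\<lambda>z. height (snd (snd z)) * bump h o1 o2 z) \<in> borel_measurable borel"
    by (rule borel_measurable_ptI) measurable
  show "(0::real) < 1 / 2 ^ n" by simp
  fix z
  show "norm (height (snd (snd z)) * bump h o1 o2 z) \<le> 1"
    if "z \<in> {o1 - 5/2 * h..o1 + 5/2 * h} \<times> {o2 - 5/2 * h..o2 + 5/2 * h} \<times> {1 / 2 ^ n..5/2 * 2 ^ n}"
  proof -
    have "snd (snd z) > 0" using that pos_if_ge by auto
    then show ?thesis using height_range bump_range by (simp add: abs_mult mult_le_one)
  qed
  show "height (snd (snd z)) * bump h o1 o2 z = 0" if "z \<in> G"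
    "z \<notin> {o1 - 5/2 * h..o1 + 5/2 * h} \<times> {o2 - 5/2 * h..o2 + 5/2 * h} \<times> {1 / 2 ^ n..5/2 * 2 ^ n}"
  proof (rule ccontr)
    assume nz: "\<not> ?thesis"
    then have b: "bump h o1 o2 z \<noteq> 0" and c: "height (snd (snd z)) \<noteq> 0" by auto
    have "snd (snd z) > 0" using that(1) by (simp add: G_height)
    from height_supp[OF this c] bump_supp[OF b assms] that(2) show False
      unfolding mem_Times_iff atLeastAtMost_iff abs_le_iff by linarith
  qed
qed

text \<open>
  The offsets do not occur in the value, so the two poles of a dipole have equal integrals.
\<close>

lemma integral_height_bump:
  assumes "h > 0"
  shows "(\<integral>z. height (snd (snd z)) * bump h o1 o2 z \<partial>haar) =
    enn2real ((\<integral>\<^sup>+b. indicator {0<..} b * (ennreal (height b) * ennreal (1 / (b * (1 / h)\<^sup>2))) \<partial>lborel)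
      * (\<integral>\<^sup>+t. ennreal (P t) \<partial>lborel) * (\<integral>\<^sup>+t. ennreal (P t) \<partial>lborel))"
proof -
  have "(\<integral>z. height (snd (snd z)) * bump h o1 o2 z \<partial>haar) =
      enn2real (\<integral>\<^sup>+z. ennreal (height (snd (snd z)) * bump h o1 o2 z) \<partial>haar)"
    by (intro integral_eq_nn_integral borel_measurable_haar borel_measurable_ptI AE_I2)
      (use height_range bump_range in \<open>auto simp: G_height\<close>)
  also have "(\<integral>\<^sup>+z. ennreal (height (snd (snd z)) * bump h o1 o2 z) \<partial>haar) =
      (\<integral>\<^sup>+(y1, y2, b). ennreal (height b) * ennreal (P (- o1 / h + 1 / h * y1))
        * ennreal (P (- o2 / h + 1 / h * y2)) \<partial>haar)"
    using assms
    by (intro nn_integral_cong)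
      (auto simp: G_def bump_def height_range P_range ennreal_mult[symmetric] mult.assoc diff_divide_distrib)
  also have "\<dots> = (\<integral>\<^sup>+b. indicator {0<..} b * (ennreal (height b) * ennreal (1 / (b * (1 / h)\<^sup>2))) \<partial>lborel)
      * (\<integral>\<^sup>+t. ennreal (P t) \<partial>lborel) * (\<integral>\<^sup>+t. ennreal (P t) \<partial>lborel)"
    by (rule nn_integral_haar_product) (use assms in \<open>auto\<close>)
  finally show ?thesis .
qed

lemma dipole_eq_bumps: "dipole (k, l1, l2) z = bump (\<theta> * mesh k) (2 * real l1 * mesh k) (2 * real l2 * mesh k) z
   - bump (\<theta> * mesh k) ((2 * real l1 + 1) * mesh k) ((2 * real l2 + 1) * mesh k) z"
  by (simp add: dipole_def bump0_def bump1_def)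

lemma integral_height_dipole: "(\<integral>z. height (snd (snd z)) * dipole j z \<partial>haar) = 0"
proof -
  obtain k l1 l2 where j: "j = (k, l1, l2)" by (cases j)
  have h: "\<theta> * mesh k > 0" using \<theta>_bounds by simp
  show ?thesis
    unfolding j dipole_eq_bumps right_diff_distrib
    by (subst Bochner_Integration.integral_diff)
      (use h in \<open>simp_all add: integrable_height_bump integral_height_bump\<close>)
qed

lemma sum_signed_prod:
  assumes "j \<in> cells"
  shows "(\<Sum>A\<in>Pow cells. rsign A j * (of_real (weight z) * signed_prod A z)) =
    2 ^ card cells * (\<i> * of_real (1 / sqrt n)) * of_real (height (snd (snd z)) * dipole j z)"
proof -
  have "(\<Sum>A\<in>Pow cells. rsign A j * (of_real (weight z) * signed_prod A z)) =
     of_real (weight z) * (\<Sum>A\<in>Pow cells. rsign A j * signed_prod A z)"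
    by (simp add: sum_distrib_left mult.left_commute)
  also have "\<dots> = of_real (weight z) * (2 ^ card cells * (\<i> * of_real (1 / sqrt n * dipole j z)))"
    unfolding signed_prod_def by (subst sum_rsign_prod) (use assms in simp_all)
  also have "\<dots> = 2 ^ card cells * (\<i> * of_real (1 / sqrt n)) * of_real (weight z * dipole j z)"
    by simp
  finally show ?thesis by (simp only: weight_dipole[OF assms])
qed

lemma sum_mean:
  assumes "j \<in> cells"
  shows "(\<Sum>A\<in>Pow cells. rsign A j * mean A) = 0"
proof -
  have "(\<Sum>A\<in>Pow cells. rsign A j * (\<integral>z. of_real (weight z) * signed_prod A z \<partial>haar)) =
      (\<integral>z. (\<Sum>A\<in>Pow cells. rsign A j * (of_real (weight z) * signed_prod A z)) \<partial>haar)"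
    using integrable_weight_prod
    by (subst Bochner_Integration.integral_sum) (auto intro!: integrable_mult_right)
  also have "\<dots> = 2 ^ card cells * (\<i> * of_real (1 / sqrt n)) *
      (\<integral>z. of_real (height (snd (snd z)) * dipole j z) \<partial>haar)"
    unfolding sum_signed_prod[OF assms] by (rule integral_mult_right_zero)
  also have "\<dots> = 0" unfolding integral_complex_of_real integral_height_dipole by simp
  finally have "(\<Sum>A\<in>Pow cells. rsign A j * (\<integral>z. of_real (weight z) * signed_prod A z \<partial>haar)) = 0" .
  then show ?thesis
    unfolding mean_def times_divide_eq_right sum_divide_distrib[symmetric] by simp
qed

text \<open>
  Averaging against one sign recovers its dipole. The means drop out by \<open>sum_mean\<close>, and the horizontal
  cutoff equals 1 on the dipole.
\<close>

lemma sum_test_fun: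
  assumes "j \<in> cells"
  shows "(\<Sum>A\<in>Pow cells. rsign A j * test_fun A z) =
    2 ^ card cells * (\<i> * of_real (1 / sqrt n)) * of_real (height (snd (snd z)) * dipole j z)"
proof -
  have "(\<Sum>A\<in>Pow cells. rsign A j * test_fun A z) =
     (\<Sum>A\<in>Pow cells. rsign A j * (of_real (weight z) * signed_prod A z))
      - of_real (weight z) * (\<Sum>A\<in>Pow cells. rsign A j * mean A)"
    by (simp add: test_fun_def right_diff_distrib sum_subtractf sum_distrib_left mult.left_commute)
  then show ?thesis by (simp only: sum_mean[OF assms] sum_signed_prod[OF assms]) simp
qed

text \<open>
  The Calderon-Zygmund set with centre height 1, \<open>r = n ln 2 + 1\<close> and \<open>L = 10 T 4\<^sup>n\<close>. The summand 1
  in \<open>r\<close> gives room for the factor \<open>5/2 < e\<close> in the support of the cutoff.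
\<close>

definition CZ_box :: "pt set" where
  "CZ_box = {- (5 * T * 4 ^ n)..5 * T * 4 ^ n} \<times> {- (5 * T * 4 ^ n)..5 * T * 4 ^ n} \<times>
     {exp (- (n * ln 2 + 1))..exp (n * ln 2 + 1)}"

lemma exp_n_ln2: "exp (real n * ln 2) = 2 ^ n"
  by (simp add: exp_of_nat_mult)

lemma CZ_box_in_CZ_sets:
  assumes "10 * T \<le> 64 ^ n"
  shows "CZ_box \<in> CZ_sets"
proof -
  let ?L = "10 * T * 4 ^ n" and ?r = "real n * ln 2 + 1"
  have e2: "exp (2 * ?r) = 4 ^ n * exp 2"
  proof -
    have "exp (2 * ?r) = (exp (real n * ln 2))\<^sup>2 * exp 2"
      by (simp add: ring_distribs exp_add flip: exp_double)
    also have "(exp (real n * ln 2))\<^sup>2 = 4 ^ n"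
      unfolding exp_n_ln2 by (simp add: power2_eq_square flip: power_mult_distrib)
    finally show ?thesis .
  qed
  have e8: "exp (8 * ?r) = 4 ^ n * 64 ^ n * exp 8"
  proof -
    have "exp (8 * ?r) = exp (real n * ln 2) ^ 8 * exp 8"
      by (simp add: ring_distribs exp_add flip: exp_of_nat_mult)
    also have "exp (real n * ln 2) ^ 8 = (2 ^ 8) ^ n"
      unfolding exp_n_ln2 by (simp only: power_mult[symmetric] mult.commute)
    finally show ?thesis by (simp flip: power_mult_distrib)
  qed
  have "exp (2::real) = (exp 1)\<^sup>2" by (simp flip: exp_double)
  also have "\<dots> \<le> 3\<^sup>2" using exp_le by (intro power_mono) auto
  finally have "exp (2::real) \<le> 10 * T" using T_ge by simp
  then have 1: "exp (2 * ?r) \<le> ?L" unfolding e2 by simp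
  have "10 * T * 1 < 64 ^ n * exp 8"
    using assms by (intro mult_le_less_imp_less) (use T_ge in auto)
  then have 2: "?L < exp (8 * ?r)" unfolding e8 by simp
  have "CZ_box = {0 - ?L/2 .. 0 + ?L/2} \<times> {0 - ?L/2 .. 0 + ?L/2} \<times> {1 * exp (- ?r) .. 1 * exp ?r}"
    by (simp add: CZ_box_def mult.assoc)
  moreover have "?L > 0" using T_ge by simp
  moreover have "real n * ln 2 \<ge> 0" by simp
  then have "?r > 0" "\<not> ?r < 1" by linarith+
  moreover have "1 * exp (2 * ?r) \<le> ?L" "?L < 1 * exp (8 * ?r)" using 1 2 by simp_all
  ultimately show ?thesis
    unfolding CZ_sets_def mem_Collect_eq
    by (intro exI[of _ 0] exI[of _ ?L] exI[of _ ?r] exI[of _ 1] conjI impI)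
      (assumption | rule zero_less_one | elim notE)+
qed

lemma supp_box_subset: "supp_box \<subseteq> CZ_box"
proof -
  have "exp (1::real) \<ge> 5/2" using exp_lower_Taylor_quadratic[of "1::real"] by simp
  then have 1: "5/2 * 2 ^ n \<le> exp (n * ln 2 + 1)"
    unfolding exp_add exp_n_ln2 by (simp add: mult.commute mult_left_mono)
  have 2: "exp (- (n * ln 2 + 1)) \<le> 1 / 2 ^ n"
  proof -
    have "exp (- (n * ln 2 + 1)) \<le> exp (- (real n * ln 2))" by simp
    also have "\<dots> = 1 / 2 ^ n" unfolding exp_minus exp_n_ln2 by (simp add: inverse_eq_divide)
    finally show ?thesis .
  qed
  show ?thesis using 1 2 unfolding supp_box_def CZ_box_def by (intro Sigma_mono) auto
qed

lemma measure_CZ_box: "measure haar CZ_box = 100 * T\<^sup>2 * 16 ^ n * (2 * (n * ln 2 + 1))"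
proof -
  let ?r = "real n * ln 2 + 1"
  have r: "?r \<ge> 0" by simp
  have "emeasure haar CZ_box = ennreal ((10 * T * 4 ^ n) * (10 * T * 4 ^ n) * ln (exp ?r / exp (- ?r)))"
    unfolding CZ_box_def by (subst emeasure_haar_box) (use T_ge r in \<open>auto\<close>)
  also have "ln (exp ?r / exp (- ?r)) = 2 * ?r" by (simp flip: exp_diff)
  also have "(10 * T * 4 ^ n) * (10 * T * 4 ^ n) * (2 * ?r) = 100 * T\<^sup>2 * 16 ^ n * (2 * ?r)"
    by (simp add: power2_eq_square flip: power_mult_distrib)
  finally show ?thesis using r unfolding measure_def by simp
qed

text \<open>
  A test function is \<open>4 \<rho>(R)\<close> times a single atom.
\<close>

lemma
  assumes "10 * T \<le> 64 ^ n"
  shows test_fun_H1: "test_fun A \<in> H1"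
    and H1norm_test_fun: "H1norm (test_fun A) \<le> 4 * measure haar CZ_box"
proof -
  define \<rho> where "\<rho> = measure haar CZ_box"
  have "real n * ln 2 + 1 > 0" by (smt (verit) ln_gt_zero mult_nonneg_nonneg of_nat_0_le_iff)
  then have \<rho>: "\<rho> > 0" using T_ge unfolding \<rho>_def measure_CZ_box by simp
  define a where "a z = test_fun A z / of_real (4 * \<rho>)" for z
  define c :: "nat \<Rightarrow> complex" where "c j = (if j = 0 then of_real (4 * \<rho>) else 0)" for j
  have "atom a"
    unfolding atom_def
  proof (intro conjI bexI[OF _ CZ_box_in_CZ_sets[OF assms]])
    show "integrable haar a" unfolding a_def using integrable_test_fun by simp
    show "AE z in haar. z \<notin> CZ_box \<longrightarrow> a z = 0"
    proof (intro AE_I2 impI)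
      fix z assume "z \<in> space haar" "z \<notin> CZ_box"
      then have "test_fun A z = 0" using supp_box_subset by (intro test_fun_supp) auto
      then show "a z = 0" by (simp add: a_def)
    qed
    show "AE z in haar. norm (a z) \<le> 1 / measure haar CZ_box"
      using norm_test_fun \<rho> by (intro AE_I2) (simp add: a_def norm_divide norm_mult \<rho>_def[symmetric] field_simps)
    show "(\<integral>z. a z \<partial>haar) = 0" unfolding a_def using integral_test_fun by simp
  qed
  moreover have "summable (\<lambda>j. norm (c j))"
    by (rule summable_finite[of "{0}"]) (auto simp: c_def)
  moreover have "(\<lambda>m. L1norm (\<lambda>z. test_fun A z - (\<Sum>j<m. c j * a z))) \<longlonglongrightarrow> 0"
  proof (rule tendsto_eventually)
    have "L1norm (\<lambda>z. test_fun A z - (\<Sum>j<m. c j * a z)) = 0" if "m \<ge> 1" for m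
    proof -
      have "(\<Sum>j<m. c j * a z) = test_fun A z" for z
      proof -
        have "(\<Sum>j<m. c j * a z) = (\<Sum>j\<in>{0}. c j * a z)"
          using that by (intro sum.mono_neutral_right) (auto simp: c_def)
        then show ?thesis using \<rho> by (simp add: c_def a_def)
      qed
      then show ?thesis by (simp add: L1norm_def)
    qed
    then show "eventually (\<lambda>m. L1norm (\<lambda>z. test_fun A z - (\<Sum>j<m. c j * a z)) = 0) sequentially"
      using eventually_sequentially by blast
  qed
  ultimately have dec: "atomic_decomposition (test_fun A) c (\<lambda>_. a)"
    by (simp add: atomic_decomposition_def)
  then show "test_fun A \<in> H1" using integrable_test_fun by (auto simp: H1_def)
  have "(\<Sum>j. norm (c j)) = 4 * \<rho>"
    by (subst suminf_finite[of "{0}"]) (use \<rho> in \<open>auto simp: c_def norm_mult\<close>)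
  then have "4 * \<rho> \<in> {\<Sum>j. norm (c j) | c A'. atomic_decomposition (test_fun A) c A'}"
    using dec by force
  moreover have "bdd_below {\<Sum>j. norm (c j) | c A'. atomic_decomposition (test_fun A) c A'}"
    by (rule bdd_belowI[of _ 0]) (auto simp: atomic_decomposition_def intro: suminf_nonneg)
  ultimately show "H1norm (test_fun A) \<le> 4 * measure haar CZ_box"
    unfolding H1norm_def \<rho>_def[symmetric] by (intro cInf_lower)
qed

lemma test_fun_smooth:
  assumes P: "\<And>k. Ck_on k UNIV P"
  shows "test_fun A \<in> test_functions"
proof -
  have of_real: "Ck_on k G (\<lambda>z. complex_of_real (f z))" if "Ck_on k G f" for f k
    by (rule Ck_on_linear_comp[OF open_G bounded_linear_of_real that])
  have c: "Ck_on k G (\<lambda>z. P (L z + d))" if "bounded_linear L" for L :: "pt \<Rightarrow> real" and d k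
    by (rule Ck_on_affine_comp[OF open_G that _ P]) simp
  have P1: "Ck_on k G (\<lambda>z. P (fst z * a + d))" and P2: "Ck_on k G (\<lambda>z. P (fst (snd z) * a + d))"
    and P3: "Ck_on k G (\<lambda>z. P (snd (snd z) * a + d))" for a d k
    by (intro c bounded_linear_mult_const[THEN bounded_linear_compose] bounded_linear_fst
        bounded_linear_snd bounded_linear_compose[OF bounded_linear_fst bounded_linear_snd]
        bounded_linear_compose[OF bounded_linear_snd bounded_linear_snd]
        bounded_linear_compose[OF bounded_linear_mult_left])+
  have minus: "Ck_on k G (\<lambda>z. f z - g z)" if "Ck_on k G f" "Ck_on k G g" for f g :: "pt \<Rightarrow> real" and k
    using Ck_on_add[OF open_G that(1) Ck_on_mult[OF open_G Ck_on_const[OF open_G, of k "- 1"] that(2)]] by simp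
  have w: "Ck_on k G weight" for k
    unfolding weight_def height_def plateau_def
    using P1[of k "1 / (2 * T * 4 ^ n)" 0] P2[of k "1 / (2 * T * 4 ^ n)" 0]
      P3[of k "1 / 2 ^ n" 0] P3[of k "2 ^ n" 0]
    by (intro Ck_on_mult[OF open_G] minus) simp_all
  have b: "Ck_on k G (bump h o1 o2)" for k h o1 o2
    unfolding bump_def
    using P1[of k "1 / h" "- o1 / h"] P2[of k "1 / h" "- o2 / h"]
    by (intro Ck_on_mult[OF open_G]) (simp_all add: diff_divide_distrib)
  have d: "Ck_on k G (dipole j)" for k j
  proof -
    obtain m l1 l2 where j: "j = (m, l1, l2)" by (cases j)
    show ?thesis unfolding j dipole_eq_bumps by (intro minus b)
  qed
  have s: "Ck_on k G (signed_prod A)" for k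
  proof -
    have "Ck_on k G (\<lambda>z. \<Prod>j\<in>S. 1 + rsign A j * (\<i> * of_real (1 / sqrt n * dipole j z)))"
      if "finite S" for S
      using that
    proof induction
      case (insert j S)
      have "Ck_on k G (\<lambda>z. (1 + rsign A j * (\<i> * of_real (1 / sqrt n * dipole j z))) *
          (\<Prod>j\<in>S. 1 + rsign A j * (\<i> * of_real (1 / sqrt n * dipole j z))))"
        by (intro Ck_on_mult[OF open_G] Ck_on_add[OF open_G] of_real Ck_on_const[OF open_G] d insert)
      then show ?case using insert by simp
    qed (simp add: Ck_on_const[OF open_G])
    then show ?thesis unfolding signed_prod_def by simp
  qed
  have "Ck_on k G (\<lambda>z. of_real (weight z) * (signed_prod A z + (- mean A)))" for k
    by (intro Ck_on_mult[OF open_G] Ck_on_add[OF open_G] of_real w s Ck_on_const[OF open_G])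
  then have "Ck_on k G (test_fun A)" for k by (simp add: test_fun_def[abs_def])
  moreover have "compact supp_box"
    unfolding supp_box_def by (intro compact_Times) auto
  moreover have "supp_box \<subseteq> G"
  proof -
    show ?thesis using pos_if_ge by (auto simp: supp_box_def G_def)
  qed
  ultimately show ?thesis
    using test_fun_supp by (auto simp: test_functions_def smooth_on_def)
qed

end


section \<open>Convolving a dipole with the kernel\<close>

text \<open>
  The kernel enters only through its values at height at least 10, and through a separation: up to the
  sign \<open>\<sigma>\<close>, its small dilates are at least \<open>\<mu> + \<kappa>\<close> near \<open>(1, 1, 1)\<close> and at most \<open>\<mu> - \<kappa>\<close> near
  \<open>(0, 0, 1)\<close>. The dilation parameter is the height of a point of the support divided by \<open>mesh k\<close>,
  which is at most \<open>5 / (2 T)\<close>.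
\<close>

locale Riesz_test = test_atoms P T \<theta> n
  for P :: "real \<Rightarrow> real" and T \<theta> :: real and n :: nat +
  fixes i j :: nat and K :: "pt \<Rightarrow> real" and \<sigma> \<mu> \<kappa> :: real
  assumes K_eq: "snd (snd y) \<ge> 10 \<Longrightarrow> K y = Riesz_form i j 1 y"
    and \<sigma>_abs: "\<bar>\<sigma>\<bar> = 1" and \<kappa>_pos: "\<kappa> > 0"
    and near_one: "\<lbrakk>0 < t; t \<le> 5 / (2 * T); \<bar>\<xi>1 - 1\<bar> \<le> 4 * \<theta>; \<bar>\<xi>2 - 1\<bar> \<le> 4 * \<theta>; 1 \<le> v; v \<le> 1 + \<theta>\<rbrakk>
      \<Longrightarrow> \<mu> + \<kappa> \<le> \<sigma> * Riesz_form i j t (\<xi>1, \<xi>2, v)"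
    and near_zero: "\<lbrakk>0 < t; t \<le> 5 / (2 * T); \<bar>\<xi>1\<bar> \<le> 4 * \<theta>; \<bar>\<xi>2\<bar> \<le> 4 * \<theta>; 1 \<le> v; v \<le> 1 + \<theta>\<rbrakk>
      \<Longrightarrow> \<sigma> * Riesz_form i j t (\<xi>1, \<xi>2, v) \<le> \<mu> - \<kappa>"
begin

text \<open>
  Seen from a point of this box, and measured in units of \<open>mesh k\<close>, the positive pole of the dipole lies
  at offset close to \<open>(1, 1)\<close> and the negative one at offset close to \<open>(0, 0)\<close>.
\<close>

definition cell_box :: "nat \<times> nat \<times> nat \<Rightarrow> pt set" where
  "cell_box = (\<lambda>(k, l1, l2).
     {(2 * real l1 + 1) * mesh k..(2 * real l1 + 1 + \<theta>) * mesh k} \<times>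
     {(2 * real l2 + 1) * mesh k..(2 * real l2 + 1 + \<theta>) * mesh k} \<times>
     {mesh k..(1 + \<theta>) * mesh k})"

lemma mult_inv_eq:
  "gmult (x1, x2, u) (ginv y) =
     (x1 - u / snd (snd y) * fst y, x2 - u / snd (snd y) * fst (snd y), u / snd (snd y))"
  by (cases y) (simp add: gmult_def ginv_def)

lemma mult_inv_meas [measurable]:
  "(\<lambda>y. gmult (x1, x2, u) (ginv y)) \<in> (borel \<Otimes>\<^sub>M borel \<Otimes>\<^sub>M borel) \<rightarrow>\<^sub>M (borel \<Otimes>\<^sub>M borel \<Otimes>\<^sub>M borel)"
  unfolding mult_inv_eq by measurable

text \<open>
  Points of the support of a test function and points above height \<open>T 2\<^sup>n\<close> differ by a group element of
  height at least 10. It lies outside the ball of radius 2, where the cutoff \<open>\<Psi>\<close> vanishes and the kernel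
  is smooth.
\<close>

lemma far_from_identity:
  assumes "u \<ge> T * 2 ^ n" "b > 0" "u / b \<le> 5/2 * 2 ^ n"
  shows "b \<ge> 10"
proof -
  have "u \<le> 5/2 * 2 ^ n * b" using assms(2,3) by (simp only: pos_divide_le_eq)
  then have "T * 2 ^ n \<le> 5/2 * 2 ^ n * b" using assms(1) by (rule order_trans[rotated])
  then have "T * 2 ^ n \<le> (5/2 * b) * 2 ^ n" by (simp add: mult_ac)
  then have "T \<le> 5/2 * b" by (rule mult_right_le_imp_le) simp
  then show ?thesis using T_ge by simp
qed

text \<open>
  As \<open>F\<close> has compact support, only \<open>y\<close> in a compact box above height 10 contribute, so local
  boundedness of the kernel there is enough.
\<close>

lemma integrable_against_kernel:
  fixes F :: "pt \<Rightarrow> 'b::{banach, second_countable_topology}" and k R :: "pt \<Rightarrow> real"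
  assumes u: "u \<ge> T * 2 ^ n"
    and F_meas [measurable]: "F \<in> borel_measurable (borel \<Otimes>\<^sub>M borel \<Otimes>\<^sub>M borel)"
    and F_bound: "\<And>z. z \<in> G \<Longrightarrow> norm (F z) \<le> M"
    and F_supp: "\<And>z. z \<in> G \<Longrightarrow> F z \<noteq> 0 \<Longrightarrow> z \<in> {- S..S} \<times> {- S..S} \<times> {1 / 2 ^ n..5/2 * 2 ^ n}"
    and R_meas [measurable]: "R \<in> borel_measurable (borel \<Otimes>\<^sub>M borel \<Otimes>\<^sub>M borel)"
    and R_bound: "\<And>Y B. \<exists>C. \<forall>y \<in> {- Y..Y} \<times> {- Y..Y} \<times> {10..B}. \<bar>R y\<bar> \<le> C"
    and k_eq: "\<And>y. snd (snd y) \<ge> 10 \<Longrightarrow> k y = R y"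
  shows "integrable haar (\<lambda>y. k y *\<^sub>R F (gmult (x1, x2, u) (ginv y)))"
proof -
  have u_pos: "u > 0" using u T_ge by (smt (verit) mult_pos_pos zero_less_power)
  define H where "H y = (if snd (snd y) \<ge> 10 then R y *\<^sub>R F (gmult (x1, x2, u) (ginv y)) else 0)" for y
  have inG: "gmult (x1, x2, u) (ginv y) \<in> G" if "y \<in> G" for y
    using that u_pos by (simp add: mult_inv_eq G_height)
  have supp: "snd (snd y) \<ge> 10" "snd (snd y) \<le> u * 2 ^ n"
    "\<bar>fst y\<bar> \<le> (\<bar>x1\<bar> + \<bar>x2\<bar> + \<bar>S\<bar>) * 2 ^ n" "\<bar>fst (snd y)\<bar> \<le> (\<bar>x1\<bar> + \<bar>x2\<bar> + \<bar>S\<bar>) * 2 ^ n"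
    if "y \<in> G" "F (gmult (x1, x2, u) (ginv y)) \<noteq> 0" for y
  proof -
    obtain y1 y2 b where y: "y = (y1, y2, b)" by (cases y)
    have b: "b > 0" using that by (simp add: y G_def)
    have z: "(x1 - u / b * y1, x2 - u / b * y2, u / b) \<in> {- S..S} \<times> {- S..S} \<times> {1 / 2 ^ n..5/2 * 2 ^ n}"
      using F_supp[OF inG[OF that(1)] that(2)] unfolding mult_inv_eq by (simp add: y)
    show "snd (snd y) \<ge> 10" using far_from_identity[OF u b] z by (simp add: y)
    have bu: "b \<le> u * 2 ^ n" using z b by (simp add: divide_simps mult.commute)
    then show "snd (snd y) \<le> u * 2 ^ n" by (simp add: y)
    have *: "\<bar>w\<bar> \<le> (\<bar>x1\<bar> + \<bar>x2\<bar> + \<bar>S\<bar>) * 2 ^ n"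
      if "\<bar>u / b * w\<bar> \<le> \<bar>x1\<bar> + \<bar>x2\<bar> + \<bar>S\<bar>" for w
    proof -
      have "\<bar>w\<bar> = \<bar>u / b * w\<bar> * (b / u)" using b u_pos by (simp add: abs_mult)
      also have "\<dots> \<le> (\<bar>x1\<bar> + \<bar>x2\<bar> + \<bar>S\<bar>) * (b / u)" using that b u_pos by (intro mult_right_mono) auto
      also have "\<dots> \<le> (\<bar>x1\<bar> + \<bar>x2\<bar> + \<bar>S\<bar>) * 2 ^ n"
        using bu u_pos by (intro mult_left_mono) (auto simp: divide_le_eq mult.commute)
      finally show ?thesis .
    qed
    have "\<bar>u / b * y1\<bar> \<le> \<bar>x1\<bar> + \<bar>x2\<bar> + \<bar>S\<bar>" "\<bar>u / b * y2\<bar> \<le> \<bar>x1\<bar> + \<bar>x2\<bar> + \<bar>S\<bar>"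
      using z unfolding mem_Times_iff by auto
    from *[OF this(1)] *[OF this(2)]
    show "\<bar>fst y\<bar> \<le> (\<bar>x1\<bar> + \<bar>x2\<bar> + \<bar>S\<bar>) * 2 ^ n" "\<bar>fst (snd y)\<bar> \<le> (\<bar>x1\<bar> + \<bar>x2\<bar> + \<bar>S\<bar>) * 2 ^ n"
      by (simp_all add: y)
  qed
  define Y where "Y = (\<bar>x1\<bar> + \<bar>x2\<bar> + \<bar>S\<bar>) * 2 ^ n"
  obtain C where C: "\<And>y. y \<in> {- Y..Y} \<times> {- Y..Y} \<times> {10..u * 2 ^ n} \<Longrightarrow> \<bar>R y\<bar> \<le> C"
    using R_bound by blast
  have "integrable haar H"
  proof (rule integrable_haar_bounded[OF borel_measurable_ptI])
    show "H \<in> borel_measurable (borel \<Otimes>\<^sub>M borel \<Otimes>\<^sub>M borel)" unfolding H_def by measurable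
    show "(0::real) < 10" by simp
    fix y :: pt
    show "norm (H y) \<le> C * M" if y: "y \<in> {- Y..Y} \<times> {- Y..Y} \<times> {10..u * 2 ^ n}"
    proof -
      have "y \<in> G" using y by (auto simp: G_def)
      then have "norm (F (gmult (x1, x2, u) (ginv y))) \<le> M" using inG F_bound by blast
      moreover have "10 \<le> snd (snd y)" using y by auto
      moreover have "0 \<le> C" using C[OF y] by (rule order_trans[OF abs_ge_zero])
      ultimately show ?thesis using C[OF y] by (simp add: H_def mult_mono)
    qed
    show "H y = 0" if y: "y \<in> G" "y \<notin> {- Y..Y} \<times> {- Y..Y} \<times> {10..u * 2 ^ n}"
    proof (rule ccontr)
      assume "H y \<noteq> 0"
      then have "F (gmult (x1, x2, u) (ginv y)) \<noteq> 0" by (auto simp: H_def split: if_splits)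
      from supp[OF y(1) this] have "y \<in> {- Y..Y} \<times> {- Y..Y} \<times> {10..u * 2 ^ n}"
        by (cases y) (auto simp: Y_def abs_le_iff)
      then show False using y(2) by blast
    qed
  qed
  moreover have "k y *\<^sub>R F (gmult (x1, x2, u) (ginv y)) = H y" if "y \<in> G" for y
    using supp(1)[OF that] k_eq[of y] by (cases "F (gmult (x1, x2, u) (ginv y)) = 0") (auto simp: H_def)
  ultimately show ?thesis
    by (subst Bochner_Integration.integrable_cong[of haar haar _ H]) simp_all
qed

lemma Riesz_form_bounded:
  "\<exists>C. \<forall>y \<in> {- Y..Y} \<times> {- Y..Y} \<times> {10..B}. \<bar>Riesz_form i j 1 y\<bar> \<le> C"
proof -
  let ?X = "{- Y..Y} \<times> {- Y..Y} \<times> {10..B} :: pt set"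
  have "continuous_on ?X (Riesz_form i j 1)"
  proof (rule continuous_at_imp_continuous_on, rule ballI)
    fix y assume "y \<in> ?X"
    then have "qform 1 y > 0" by (cases y) (auto intro!: qform_pos)
    then have "isCont (\<lambda>y. (\<lambda>(t, z). Riesz_form i j t z) (1, y)) y"
      by (intro isCont_o2[where f = "\<lambda>y. (1, y)" and g = "\<lambda>(t, z). Riesz_form i j t z"]
          Riesz_form_isCont) (auto intro!: continuous_intros)
    then show "isCont (Riesz_form i j 1) y" by simp
  qed
  then have "compact (Riesz_form i j 1 ` ?X)"
    by (rule compact_continuous_image) (intro compact_Times compact_Icc)
  then obtain C where "\<forall>r \<in> Riesz_form i j 1 ` ?X. norm r \<le> C"
    using compact_imp_bounded bounded_iff by metis
  then show ?thesis by (intro exI[of _ C]) auto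
qed

lemma integrable_conv:
  fixes F :: "pt \<Rightarrow> 'b::{banach, second_countable_topology}"
  assumes "u \<ge> T * 2 ^ n" "F \<in> borel_measurable (borel \<Otimes>\<^sub>M borel \<Otimes>\<^sub>M borel)"
    and "\<And>z. z \<in> G \<Longrightarrow> norm (F z) \<le> M"
    and "\<And>z. z \<in> G \<Longrightarrow> F z \<noteq> 0 \<Longrightarrow> z \<in> {- S..S} \<times> {- S..S} \<times> {1 / 2 ^ n..5/2 * 2 ^ n}"
  shows "integrable haar (\<lambda>y. K y *\<^sub>R F (gmult (x1, x2, u) (ginv y)))"
proof (rule integrable_against_kernel[OF assms(1-4), where R = "Riesz_form i j 1"])
  show "\<exists>C. \<forall>y \<in> {- Y..Y} \<times> {- Y..Y} \<times> {10..B}. \<bar>Riesz_form i j 1 y\<bar> \<le> C" for Y B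
    by (rule Riesz_form_bounded)
qed (use K_eq in simp_all)

text \<open>
  The integral of a bump against the factor \<open>t\<^sup>2\<close>, \<open>t = u / (b mesh k)\<close>, that relates the kernel to
  its dilate by \<open>t\<close>. The same number belongs to both poles of every dipole of scale \<open>k\<close>.
\<close>

definition bump_mass :: "nat \<Rightarrow> real \<Rightarrow> real" where
  "bump_mass k u = enn2real ((\<integral>\<^sup>+b. indicator {0<..} b * (ennreal (height (u / b) * (u / (b * mesh k))\<^sup>2)
       * ennreal (1 / (b * (- (u / b) / (\<theta> * mesh k))\<^sup>2))) \<partial>lborel)
      * (\<integral>\<^sup>+t. ennreal (P t) \<partial>lborel) * (\<integral>\<^sup>+t. ennreal (P t) \<partial>lborel))"

text \<open>
  Substituting the horizontal variables produces the factor \<open>(\<theta> b mesh k / u)\<^sup>2\<close>, which cancels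
  \<open>t\<^sup>2\<close> and leaves \<open>\<theta>\<^sup>2 (\<integral> P)\<^sup>2 \<integral> height (u / b) db / b\<close>. The cutoff is 1 on a range of heights of logarithmic
  length \<open>ln (4\<^sup>n / (5/2)) \<ge> n ln 2\<close>; this is the source of the growth in \<open>n\<close>.
\<close>

lemma
  assumes u: "u \<ge> T * 2 ^ n"
  shows integrable_scaled_bump: "integrable haar (\<lambda>y. (u / (snd (snd y) * mesh k))\<^sup>2 *
      (height (u / snd (snd y)) * bump (\<theta> * mesh k) o1 o2 (gmult (x1, x2, u) (ginv y))))" (is "integrable haar ?g")
    and integral_scaled_bump: "(\<integral>y. (u / (snd (snd y) * mesh k))\<^sup>2 *
      (height (u / snd (snd y)) * bump (\<theta> * mesh k) o1 o2 (gmult (x1, x2, u) (ginv y))) \<partial>haar) = bump_mass k u"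
    and bump_mass_ge: "bump_mass k u \<ge> 4 * \<theta>\<^sup>2 * (n * ln 2)"
proof -
  let ?h = "\<theta> * mesh k"
  have h: "?h > 0" using \<theta>_bounds by simp
  have u_pos: "u > 0" using u T_ge by (smt (verit) mult_pos_pos zero_less_power)
  define F where "F z = height (snd (snd z)) * bump ?h o1 o2 z" for z
  have F_supp: "z \<in> {- S..S} \<times> {- S..S} \<times> {1 / 2 ^ n..5/2 * 2 ^ n}"
    if "z \<in> G" "F z \<noteq> 0" "S = \<bar>o1\<bar> + \<bar>o2\<bar> + 5/2 * ?h" for z S
  proof -
    have z: "height (snd (snd z)) \<noteq> 0" "bump ?h o1 o2 z \<noteq> 0" "snd (snd z) > 0"
      using that(1,2) by (auto simp: F_def G_height)
    from height_supp[OF z(3,1)] bump_supp[OF z(2) h] that(3) show ?thesis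
      unfolding mem_Times_iff atLeastAtMost_iff by linarith
  qed
  have F_range: "0 \<le> F z" "F z \<le> 1" if "z \<in> G" for z
    using that by (auto simp: F_def G_height height_range bump_range intro!: mult_le_one)
  have "integrable haar (\<lambda>y. (u / (snd (snd y) * mesh k))\<^sup>2 *\<^sub>R F (gmult (x1, x2, u) (ginv y)))"
  proof (rule integrable_against_kernel[OF u, where M = 1 and S = "\<bar>o1\<bar> + \<bar>o2\<bar> + 5/2 * ?h"])
    show "F \<in> borel_measurable (borel \<Otimes>\<^sub>M borel \<Otimes>\<^sub>M borel)" unfolding F_def by measurable
    show "norm (F z) \<le> 1" if "z \<in> G" for z using F_range[OF that] by simp
    show "\<exists>C. \<forall>y \<in> {- Y..Y} \<times> {- Y..Y} \<times> {10..B}. \<bar>(u / (snd (snd y) * mesh k))\<^sup>2\<bar> \<le> C" for Y B :: real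
    proof (intro exI ballI)
      fix y :: pt assume "y \<in> {- Y..Y} \<times> {- Y..Y} \<times> {10..B}"
      then have "mesh k * 1 \<le> mesh k * snd (snd y)" by (intro mult_left_mono) (auto intro: less_imp_le)
      then have "u / (snd (snd y) * mesh k) \<le> u / mesh k"
        using u_pos by (intro divide_left_mono) (auto simp: mult.commute intro!: mult_pos_pos less_le_trans[OF mesh_pos[of k]])
      then show "\<bar>(u / (snd (snd y) * mesh k))\<^sup>2\<bar> \<le> (u / mesh k)\<^sup>2"
        using u_pos \<open>y \<in> _\<close> by (auto intro!: power_mono divide_nonneg_pos mult_pos_pos)
    qed
    show "z \<in> {- (\<bar>o1\<bar> + \<bar>o2\<bar> + 5/2 * ?h)..\<bar>o1\<bar> + \<bar>o2\<bar> + 5/2 * ?h} \<times>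
        {- (\<bar>o1\<bar> + \<bar>o2\<bar> + 5/2 * ?h)..\<bar>o1\<bar> + \<bar>o2\<bar> + 5/2 * ?h} \<times> {1 / 2 ^ n..5/2 * 2 ^ n}"
      if "z \<in> G" "F z \<noteq> 0" for z
      using that refl by (rule F_supp)
  qed simp_all
  then show int: "integrable haar ?g" by (simp add: F_def mult_inv_eq)
  have nonneg: "?g y \<ge> 0" if "y \<in> G" for y
    using that u_pos by (simp add: G_height height_range bump_range)
  have nn: "(\<integral>\<^sup>+y. ennreal (?g y) \<partial>haar) =
    (\<integral>\<^sup>+b. indicator {0<..} b * (ennreal (height (u / b) * (u / (b * mesh k))\<^sup>2)
       * ennreal (1 / (b * (- (u / b) / ?h)\<^sup>2))) \<partial>lborel)
      * (\<integral>\<^sup>+t. ennreal (P t) \<partial>lborel) * (\<integral>\<^sup>+t. ennreal (P t) \<partial>lborel)"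
  proof -
    have "(\<integral>\<^sup>+y. ennreal (?g y) \<partial>haar) =
      (\<integral>\<^sup>+(y1, y2, b). ennreal (height (u / b) * (u / (b * mesh k))\<^sup>2) *
         ennreal (P ((x1 - o1) / ?h + - (u / b) / ?h * y1)) *
         ennreal (P ((x2 - o2) / ?h + - (u / b) / ?h * y2)) \<partial>haar)"
    proof (rule nn_integral_cong)
      fix y assume "y \<in> space haar"
      then obtain y1 y2 b where y: "y = (y1, y2, b)" "b > 0" by (cases y) (simp add: G_def)
      have "(x1 - u / b * y1 - o1) / ?h = (x1 - o1) / ?h + - (u / b) / ?h * y1"
        "(x2 - u / b * y2 - o2) / ?h = (x2 - o2) / ?h + - (u / b) / ?h * y2"
        by (simp_all add: diff_divide_distrib add_divide_distrib)
      then show "ennreal (?g y) = (case y of (y1, y2, b) \<Rightarrow>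
         ennreal (height (u / b) * (u / (b * mesh k))\<^sup>2) *
         ennreal (P ((x1 - o1) / ?h + - (u / b) / ?h * y1)) *
         ennreal (P ((x2 - o2) / ?h + - (u / b) / ?h * y2)))"
        using height_range[of "u / b"] P_range u_pos y
        by (simp add: mult_inv_eq bump_def ennreal_mult[symmetric] mult_ac)
    qed
    also have "\<dots> = (\<integral>\<^sup>+b. indicator {0<..} b * (ennreal (height (u / b) * (u / (b * mesh k))\<^sup>2)
       * ennreal (1 / (b * (- (u / b) / ?h)\<^sup>2))) \<partial>lborel)
      * (\<integral>\<^sup>+t. ennreal (P t) \<partial>lborel) * (\<integral>\<^sup>+t. ennreal (P t) \<partial>lborel)"
      by (rule nn_integral_haar_product) (use h u_pos mesh_pos[of k] \<theta>_bounds in auto)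
    finally show ?thesis .
  qed
  show eq: "(\<integral>y. ?g y \<partial>haar) = bump_mass k u"
    unfolding bump_mass_def nn[symmetric] using int nonneg
    by (intro integral_eq_nn_integral AE_I2) auto
  have P2: "(\<integral>\<^sup>+t. ennreal (P t) \<partial>lborel) \<ge> ennreal 2"
  proof -
    have "ennreal 2 = (\<integral>\<^sup>+t. indicator {-1..1::real} t \<partial>lborel)" by simp
    also have "\<dots> \<le> (\<integral>\<^sup>+t. ennreal (P t) \<partial>lborel)"
      by (intro nn_integral_mono) (auto simp: indicator_def P_one)
    finally show ?thesis .
  qed
  have pn: "(2::real) ^ n > 0" by simp
  have main: "(\<integral>\<^sup>+b. indicator {0<..} b * (ennreal (height (u / b) * (u / (b * mesh k))\<^sup>2)
       * ennreal (1 / (b * (- (u / b) / ?h)\<^sup>2))) \<partial>lborel) \<ge> ennreal (\<theta>\<^sup>2 * (n * ln 2))"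
  proof -
    let ?p = "u / 2 ^ n" and ?q = "u * 2 ^ n / (5/2)"
    have p: "?p > 0" using u_pos by simp
    have q: "2 ^ n \<le> ?q / ?p"
    proof -
      have "2 ^ n * (5/2) \<le> 2 ^ n * (2::real) ^ n" using two_le_pow by (intro mult_left_mono) auto
      then show ?thesis using u_pos by (simp add: field_simps)
    qed
    moreover have "1 \<le> (2::real) ^ n" by simp
    ultimately have "1 \<le> ?q / ?p" by linarith
    then have pq: "?p \<le> ?q" using p by (simp only: le_divide_eq_1_pos)
    have "n * ln 2 = ln ((2::real) ^ n)" by (simp add: ln_realpow)
    also have "\<dots> \<le> ln (?q / ?p)" by (intro ln_mono q pn)
    finally have "ennreal (\<theta>\<^sup>2 * (n * ln 2)) \<le> ennreal (\<theta>\<^sup>2 * ln (?q / ?p))"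
      by (intro ennreal_leI mult_left_mono) simp_all
    also have "\<dots> = ennreal (\<theta>\<^sup>2) * ennreal (ln (?q / ?p))"
      by (rule ennreal_mult') simp
    also have "\<dots> = (\<integral>\<^sup>+b. ennreal (\<theta>\<^sup>2) * (ennreal (1 / b) * indicator {?p..?q} b) \<partial>lborel)"
      by (subst nn_integral_cmult) (simp_all only: nn_integral_inverse[OF p pq], measurable)
    also have "\<dots> \<le> (\<integral>\<^sup>+b. indicator {0<..} b * (ennreal (height (u / b) * (u / (b * mesh k))\<^sup>2)
       * ennreal (1 / (b * (- (u / b) / ?h)\<^sup>2))) \<partial>lborel)"
    proof (rule nn_integral_mono)
      fix b :: real
      show "ennreal (\<theta>\<^sup>2) * (ennreal (1 / b) * indicator {?p..?q} b) \<le>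
        indicator {0<..} b * (ennreal (height (u / b) * (u / (b * mesh k))\<^sup>2)
         * ennreal (1 / (b * (- (u / b) / ?h)\<^sup>2)))"
      proof (cases "b \<in> {?p..?q}")
        case True
        then have b: "b > 0" using p by auto
        have "height (u / b) = 1"
        proof (rule height_one)
          show "5/2 / 2 ^ n \<le> u / b" "u / b \<le> 2 ^ n"
            using True b pn by (simp_all add: field_simps)
        qed
        moreover have "(u / (b * mesh k))\<^sup>2 * (1 / (b * (- (u / b) / ?h)\<^sup>2)) = \<theta>\<^sup>2 * (1 / b)"
        proof -
          have "u \<noteq> 0" "b \<noteq> 0" "mesh k \<noteq> 0" "\<theta> \<noteq> 0"
            using u_pos b mesh_pos[of k] \<theta>_bounds by auto
          then show ?thesis by (simp add: power_divide power_mult_distrib divide_simps)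
        qed
        ultimately show ?thesis using True b by (simp add: ennreal_mult[symmetric])
      qed simp
    qed
    finally show ?thesis .
  qed
  have "ennreal (4 * \<theta>\<^sup>2 * (n * ln 2)) = ennreal (\<theta>\<^sup>2 * (n * ln 2) * 2 * 2)"
    by (rule arg_cong[where f = ennreal]) simp
  also have "\<dots> = ennreal (\<theta>\<^sup>2 * (n * ln 2)) * ennreal 2 * ennreal 2"
    by (simp only: ennreal_mult'' zero_le_numeral)
  also have "\<dots> \<le> (\<integral>\<^sup>+y. ennreal (?g y) \<partial>haar)"
    unfolding nn by (intro mult_mono main P2) auto
  also have "\<dots> = ennreal (bump_mass k u)"
  proof -
    have "AE y in haar. 0 \<le> ?g y" using nonneg by (intro AE_I2) simp
    from nn_integral_eq_integral[OF int this] show ?thesis by (simp only: eq)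
  qed
  finally show "bump_mass k u \<ge> 4 * \<theta>\<^sup>2 * (n * ln 2)"
    by (simp add: ennreal_le_iff bump_mass_def)
qed

end

context Riesz_test begin

text \<open>
  By homogeneity the kernel at \<open>y\<close> is \<open>t\<^sup>2\<close> times its dilate evaluated at the offset from \<open>x\<close> in units
  of \<open>mesh k\<close>. The separation of the two values then applies on the support of each pole.
\<close>

lemma dipole_kernel_pointwise:
  assumes x: "(x1, x2, u) \<in> cell_box (k, l1, l2)" and u: "u \<ge> T * 2 ^ n" and y: "y \<in> G"
  defines "z \<equiv> gmult (x1, x2, u) (ginv y)" and "b \<equiv> snd (snd y)"
  shows "(\<mu> + \<kappa>) * ((u / (b * mesh k))\<^sup>2 * (height (u / b) *
        bump (\<theta> * mesh k) (2 * real l1 * mesh k) (2 * real l2 * mesh k) z))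
     - (\<mu> - \<kappa>) * ((u / (b * mesh k))\<^sup>2 * (height (u / b) *
        bump (\<theta> * mesh k) ((2 * real l1 + 1) * mesh k) ((2 * real l2 + 1) * mesh k) z))
    \<le> \<sigma> * (K y * (height (u / b) * dipole (k, l1, l2) z))"
proof (cases "height (u / b) = 0")
  case False
  let ?U = "mesh k" and ?h = "\<theta> * mesh k"
  let ?ba = "bump ?h (2 * real l1 * ?U) (2 * real l2 * ?U) z"
  let ?bb = "bump ?h ((2 * real l1 + 1) * ?U) ((2 * real l2 + 1) * ?U) z"
  have U: "?U > 0" by simp
  have h: "?h > 0" using \<theta>_bounds by simp
  have u_pos: "u > 0" using u T_ge by (smt (verit) mult_pos_pos zero_less_power)
  obtain y1 y2 where yb: "y = (y1, y2, b)" unfolding b_def by (cases y) simp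
  have b: "b > 0" using y by (simp add: yb G_def)
  have hs: "u / b \<le> 5/2 * 2 ^ n" using height_supp(2)[OF _ False] u_pos b by simp
  then have b10: "b \<ge> 10" using far_from_identity[OF u b] by blast
  define t where "t = u / (b * ?U)"
  have t: "t > 0" using u_pos b by (simp add: t_def)
  have t_le: "t \<le> 5 / (2 * T)"
  proof -
    have "?U \<ge> T * 2 ^ n" using T_ge by (simp add: mesh_def power_add)
    have "t = (u / b) / ?U" by (simp add: t_def)
    also have "\<dots> \<le> (5/2 * 2 ^ n) / (T * 2 ^ n)"
      using hs \<open>?U \<ge> _\<close> u_pos b T_ge by (intro frac_le) auto
    finally show ?thesis by simp
  qed
  define v where "v = u / ?U"
  have v: "1 \<le> v" "v \<le> 1 + \<theta>" using x U by (auto simp: cell_box_def v_def divide_simps)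
  have xi: "2 * real l1 + 1 \<le> x1 / ?U" "x1 / ?U \<le> 2 * real l1 + 1 + \<theta>"
    "2 * real l2 + 1 \<le> x2 / ?U" "x2 / ?U \<le> 2 * real l2 + 1 + \<theta>"
    using x U by (auto simp: cell_box_def pos_le_divide_eq pos_divide_le_eq)
  have z: "z = (x1 - u / b * y1, x2 - u / b * y2, u / b)"
    unfolding z_def mult_inv_eq yb by simp
  have K: "K y = t\<^sup>2 * Riesz_form i j t (x1 / ?U - fst z / ?U, x2 / ?U - fst (snd z) / ?U, v)"
  proof -
    have c: "t * y1 = x1 / ?U - fst z / ?U" "t * y2 = x2 / ?U - fst (snd z) / ?U" "t * b = v"
      using U b by (simp_all add: t_def v_def z diff_divide_distrib)
    have "Riesz_form i j (t * 1) (t * y1, t * y2, t * b) = Riesz_form i j 1 y / t\<^sup>2"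
      unfolding yb by (rule Riesz_form_scale[OF t])
    then show ?thesis using K_eq[of y] b10 t unfolding c by (simp add: yb)
  qed
  let ?R = "Riesz_form i j t (x1 / ?U - fst z / ?U, x2 / ?U - fst (snd z) / ?U, v)"
  have near: "\<bar>s / ?U - c\<bar> \<le> 5/2 * \<theta>" if "\<bar>s - c * ?U\<bar> \<le> 5/2 * ?h" for s c
  proof -
    have "\<bar>s - c * ?U\<bar> / ?U \<le> 5/2 * \<theta>" using that U by (simp add: pos_divide_le_eq)
    moreover have "s / ?U - c = (s - c * ?U) / ?U" using U by (simp add: diff_divide_distrib)
    ultimately show ?thesis by (simp only: abs_divide abs_of_pos[OF U])
  qed
  have 0: "(\<mu> + \<kappa>) * ?ba \<le> (\<sigma> * ?R) * ?ba"
  proof (cases "?ba = 0")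
    case False
    from near[OF bump_supp(1)[OF False h]] near[OF bump_supp(2)[OF False h]]
    have "\<mu> + \<kappa> \<le> \<sigma> * ?R"
      using xi \<theta>_bounds by (intro near_one t t_le v) (unfold abs_le_iff, linarith+)
    then show ?thesis using bump_range by (intro mult_right_mono) auto
  qed simp
  have 1: "(\<sigma> * ?R) * ?bb \<le> (\<mu> - \<kappa>) * ?bb"
  proof (cases "?bb = 0")
    case False
    from near[OF bump_supp(1)[OF False h]] near[OF bump_supp(2)[OF False h]]
    have "\<sigma> * ?R \<le> \<mu> - \<kappa>"
      using xi \<theta>_bounds by (intro near_zero t t_le v) (unfold abs_le_iff, linarith+)
    then show ?thesis using bump_range by (intro mult_right_mono) auto
  qed simp
  have "t\<^sup>2 * height (u / b) \<ge> 0" using height_range[of "u / b"] u_pos b by simp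
  moreover have "(\<mu> + \<kappa>) * ?ba - (\<mu> - \<kappa>) * ?bb \<le> (\<sigma> * ?R) * ?ba - (\<sigma> * ?R) * ?bb"
    using 0 1 by linarith
  ultimately have "t\<^sup>2 * height (u / b) * ((\<mu> + \<kappa>) * ?ba - (\<mu> - \<kappa>) * ?bb) \<le>
      t\<^sup>2 * height (u / b) * ((\<sigma> * ?R) * ?ba - (\<sigma> * ?R) * ?bb)"
    by (rule mult_left_mono[rotated])
  then show ?thesis
    unfolding dipole_eq_bumps K t_def[symmetric] by (simp add: algebra_simps)
qed simp

lemma cell_box_height:
  assumes "(x1, x2, u) \<in> cell_box m" shows "u \<ge> T * 2 ^ n"
proof -
  have "T * 2 ^ n \<le> mesh (fst m)" using T_ge by (simp add: mesh_def power_add)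
  then show ?thesis using assms by (cases m) (auto simp: cell_box_def)
qed

lemma dipole_height_supp:
  assumes "z \<in> G" "m \<in> cells" "height (snd (snd z)) * dipole m z \<noteq> 0"
  shows "z \<in> supp_box"
  using assms weight_dipole[OF assms(2), of z] weight_zero[of z] by fastforce

lemma integrable_conv_supp_box:
  fixes F :: "pt \<Rightarrow> 'b::{banach, second_countable_topology}"
  assumes "u \<ge> T * 2 ^ n" "F \<in> borel_measurable (borel \<Otimes>\<^sub>M borel \<Otimes>\<^sub>M borel)"
    and "\<And>z. z \<in> G \<Longrightarrow> norm (F z) \<le> M"
    and "\<And>z. z \<in> G \<Longrightarrow> F z \<noteq> 0 \<Longrightarrow> z \<in> supp_box"
  shows "integrable haar (\<lambda>y. K y *\<^sub>R F (gmult (x1, x2, u) (ginv y)))"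
  by (rule integrable_conv[OF assms(1-3), where S = "5 * T * 4 ^ n"])
    (use assms(4) in \<open>simp_all add: supp_box_def\<close>)

text \<open>
  Both poles have the same mass, so the common level \<open>\<mu>\<close> cancels and the gap \<open>2 \<kappa>\<close> remains.
\<close>

lemma dipole_conv_lower:
  assumes x: "(x1, x2, u) \<in> cell_box m" and m: "m \<in> cells"
  shows "8 * \<kappa> * \<theta>\<^sup>2 * (n * ln 2) \<le>
    \<bar>\<integral>y. K y * (height (u / snd (snd y)) * dipole m (gmult (x1, x2, u) (ginv y))) \<partial>haar\<bar>"
proof -
  obtain k l1 l2 where kl: "m = (k, l1, l2)" by (cases m)
  have u: "u \<ge> T * 2 ^ n" by (rule cell_box_height[OF x])
  let ?g = "\<lambda>o1 o2 y. (u / (snd (snd y) * mesh k))\<^sup>2 *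
      (height (u / snd (snd y)) * bump (\<theta> * mesh k) o1 o2 (gmult (x1, x2, u) (ginv y)))"
  let ?ga = "?g (2 * real l1 * mesh k) (2 * real l2 * mesh k)"
  let ?gb = "?g ((2 * real l1 + 1) * mesh k) ((2 * real l2 + 1) * mesh k)"
  let ?f = "\<lambda>y. K y * (height (u / snd (snd y)) * dipole m (gmult (x1, x2, u) (ginv y)))"
  have f: "integrable haar ?f"
  proof -
    have "integrable haar (\<lambda>y. K y *\<^sub>R
      (\<lambda>z. height (snd (snd z)) * dipole m z) (gmult (x1, x2, u) (ginv y)))"
    proof (rule integrable_conv_supp_box[OF u, where M = 1])
      show "norm (height (snd (snd z)) * dipole m z) \<le> 1" if "z \<in> G" for z
        using that height_range[of "snd (snd z)"] dipole_bound[of m z]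
        by (auto simp: abs_mult G_height intro!: mult_le_one)
    qed (use dipole_height_supp[OF _ m] in \<open>simp_all\<close>)
    then show ?thesis by (simp add: mult_inv_eq)
  qed
  have "2 * \<kappa> * bump_mass k u = (\<mu> + \<kappa>) * bump_mass k u - (\<mu> - \<kappa>) * bump_mass k u"
    by (simp add: algebra_simps)
  also have "\<dots> = (\<integral>y. (\<mu> + \<kappa>) * ?ga y - (\<mu> - \<kappa>) * ?gb y \<partial>haar)"
    by (subst Bochner_Integration.integral_diff)
      (simp_all add: integral_scaled_bump[OF u] integrable_scaled_bump[OF u] del: mult_eq_0_iff)
  also have "\<dots> \<le> (\<integral>y. \<sigma> * ?f y \<partial>haar)"
  proof (rule integral_mono)
    show "(\<mu> + \<kappa>) * ?ga y - (\<mu> - \<kappa>) * ?gb y \<le> \<sigma> * ?f y" if "y \<in> space haar" for y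
      unfolding kl by (rule dipole_kernel_pointwise) (use x u that in \<open>simp_all add: kl\<close>)
  qed (intro Bochner_Integration.integrable_diff integrable_mult_right integrable_scaled_bump[OF u] f)+
  also have "\<dots> \<le> \<bar>\<sigma> * (\<integral>y. ?f y \<partial>haar)\<bar>" by simp
  also have "\<dots> = \<bar>\<integral>y. ?f y \<partial>haar\<bar>" using \<sigma>_abs by (simp add: abs_mult)
  finally have "2 * \<kappa> * bump_mass k u \<le> \<bar>\<integral>y. ?f y \<partial>haar\<bar>" .
  moreover have "2 * \<kappa> * (4 * \<theta>\<^sup>2 * (n * ln 2)) \<le> 2 * \<kappa> * bump_mass k u"
    using bump_mass_ge[OF u] \<kappa>_pos by (intro mult_left_mono) auto
  ultimately show ?thesis by (simp add: mult_ac)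
qed

abbreviation TK :: "(pt \<Rightarrow> complex) \<Rightarrow> pt \<Rightarrow> complex" where
  "TK f \<equiv> conv f (\<lambda>x. complex_of_real (K x))"

text \<open>
  The sum of the moduli over all sign patterns dominates the modulus of the signed sum, in which only the
  dipole of the cell over which \<open>x\<close> lies survives.
\<close>

lemma sum_norm_TK_lower:
  assumes x: "x \<in> cell_box m" and m: "m \<in> cells"
  shows "2 ^ card cells * (8 * \<kappa> * \<theta>\<^sup>2 * (n * ln 2) / sqrt n) \<le> (\<Sum>A\<in>Pow cells. norm (TK (test_fun A) x))"
proof -
  obtain x1 x2 u where xu: "x = (x1, x2, u)" by (cases x)
  have u: "u \<ge> T * 2 ^ n" using x unfolding xu by (rule cell_box_height)
  let ?z = "\<lambda>y. gmult (x1, x2, u) (ginv y)"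
  let ?f = "\<lambda>y. K y * (height (u / snd (snd y)) * dipole m (?z y))"
  have int: "integrable haar (\<lambda>y. test_fun A (?z y) * complex_of_real (K y))" for A
  proof -
    have "integrable haar (\<lambda>y. K y *\<^sub>R test_fun A (?z y))"
      by (rule integrable_conv_supp_box[OF u test_fun_meas, where M = 4])
        (use norm_test_fun test_fun_supp in blast)+
    then show ?thesis by (simp add: scaleR_conv_of_real mult.commute)
  qed
  have "(\<Sum>A\<in>Pow cells. rsign A m * TK (test_fun A) x) =
      (\<integral>y. (\<Sum>A\<in>Pow cells. rsign A m * (test_fun A (?z y) * complex_of_real (K y))) \<partial>haar)"
    unfolding conv_def xu by (subst Bochner_Integration.integral_sum) (use int in auto)
  also have "\<dots> = (\<integral>y. 2 ^ card cells * (\<i> * of_real (1 / sqrt n)) * complex_of_real (?f y) \<partial>haar)"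
  proof (rule Bochner_Integration.integral_cong[OF refl])
    fix y
    have "(\<Sum>A\<in>Pow cells. rsign A m * (test_fun A (?z y) * complex_of_real (K y))) =
        (\<Sum>A\<in>Pow cells. rsign A m * test_fun A (?z y)) * complex_of_real (K y)"
      by (simp add: sum_distrib_right mult.assoc)
    also have "\<dots> = 2 ^ card cells * (\<i> * of_real (1 / sqrt n)) *
        of_real (height (snd (snd (?z y))) * dipole m (?z y)) * complex_of_real (K y)"
      by (simp only: sum_test_fun[OF m])
    also have "\<dots> = 2 ^ card cells * (\<i> * of_real (1 / sqrt n)) * complex_of_real (?f y)"
      by (simp add: mult_inv_eq)
    finally show "(\<Sum>A\<in>Pow cells. rsign A m * (test_fun A (?z y) * complex_of_real (K y))) = \<dots>" .
  qed
  also have "\<dots> = 2 ^ card cells * (\<i> * of_real (1 / sqrt n)) * complex_of_real (\<integral>y. ?f y \<partial>haar)"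
    by (simp only: integral_mult_right_zero integral_complex_of_real)
  finally have eq: "(\<Sum>A\<in>Pow cells. rsign A m * TK (test_fun A) x) =
    2 ^ card cells * (\<i> * of_real (1 / sqrt n)) * complex_of_real (\<integral>y. ?f y \<partial>haar)" .
  have "2 ^ card cells * (8 * \<kappa> * \<theta>\<^sup>2 * (n * ln 2) / sqrt n)
      \<le> 2 ^ card cells * (\<bar>\<integral>y. ?f y \<partial>haar\<bar> / sqrt n)"
    using dipole_conv_lower[OF x[unfolded xu] m] by (intro mult_left_mono divide_right_mono) auto
  also have "\<dots> = norm (\<Sum>A\<in>Pow cells. rsign A m * TK (test_fun A) x)"
    unfolding eq by (simp add: norm_mult norm_divide norm_power)
  also have "\<dots> \<le> (\<Sum>A\<in>Pow cells. norm (TK (test_fun A) x))"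
    by (rule sum_norm_le) (simp add: norm_mult)
  finally show ?thesis .
qed

text \<open>
  Heights separate different scales, as \<open>1 + \<theta> < 2\<close>; horizontal positions separate cells of one scale.
\<close>

lemma cell_box_disjoint: "disjoint_family_on cell_box cells"
proof (unfold disjoint_family_on_def, intro ballI impI)
  fix a b assume ab: "a \<in> cells" "b \<in> cells" "a \<noteq> b"
  show "cell_box a \<inter> cell_box b = {}"
  proof (rule ccontr)
    assume "cell_box a \<inter> cell_box b \<noteq> {}"
    then obtain x1 x2 u where x: "(x1, x2, u) \<in> cell_box a" "(x1, x2, u) \<in> cell_box b" by auto
    obtain k l1 l2 where a: "a = (k, l1, l2)" by (cases a)
    obtain k' l1' l2' where b: "b = (k', l1', l2')" by (cases b)
    have lt: "k \<le> k'" if "mesh k \<le> (1 + \<theta>) * mesh k'" for k k'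
    proof (rule ccontr)
      assume "\<not> k \<le> k'"
      then have "(2::real) ^ (n + Suc k') \<le> 2 ^ (n + k)" by (intro power_increasing) auto
      then have "T * 2 ^ (n + Suc k') \<le> mesh k" using T_ge unfolding mesh_def by (intro mult_left_mono) auto
      then have "2 * mesh k' \<le> mesh k" by (simp add: mesh_def)
      moreover have "(1 + \<theta>) * mesh k' < 2 * mesh k'" using \<theta>_bounds by (intro mult_strict_right_mono) auto
      ultimately show False using that by linarith
    qed
    have "mesh k \<le> (1 + \<theta>) * mesh k'" "mesh k' \<le> (1 + \<theta>) * mesh k"
      using x unfolding a b by (auto simp: cell_box_def)
    then have k: "k' = k" using lt by (intro antisym) auto
    have U: "mesh k > 0" by simp
    have l: "l = l'" if "(2 * real l + 1) * mesh k \<le> (2 * real l' + 1 + \<theta>) * mesh k"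
      "(2 * real l' + 1) * mesh k \<le> (2 * real l + 1 + \<theta>) * mesh k" for l l'
    proof -
      have "2 * real l + 1 \<le> 2 * real l' + 1 + \<theta>" "2 * real l' + 1 \<le> 2 * real l + 1 + \<theta>"
        using that U by (simp_all only: mult_le_cancel_right_pos)
      then have "real l < real l' + 1" "real l' < real l + 1" using \<theta>_bounds by linarith+
      then show ?thesis by linarith
    qed
    have "(2 * real l1 + 1) * mesh k \<le> x1" "x1 \<le> (2 * real l1 + 1 + \<theta>) * mesh k"
      "(2 * real l2 + 1) * mesh k \<le> x2" "x2 \<le> (2 * real l2 + 1 + \<theta>) * mesh k"
      "(2 * real l1' + 1) * mesh k \<le> x1" "x1 \<le> (2 * real l1' + 1 + \<theta>) * mesh k"
      "(2 * real l2' + 1) * mesh k \<le> x2" "x2 \<le> (2 * real l2' + 1 + \<theta>) * mesh k"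
      using x unfolding a b k cell_box_def by simp_all
    then have "l1 = l1'" "l2 = l2'" by (meson l order_trans)+
    then show False using ab(3) a b k by simp
  qed
qed

lemma emeasure_cell_box:
  "emeasure haar (cell_box (k, l1, l2)) = ennreal ((\<theta> * mesh k)\<^sup>2 * ln (1 + \<theta>))"
proof -
  have U: "mesh k > 0" by simp
  have d: "(c + \<theta>) * mesh k - c * mesh k = \<theta> * mesh k" for c by (simp add: algebra_simps)
  have le: "c * mesh k \<le> (c + \<theta>) * mesh k" for c
    using \<theta>_bounds less_imp_le[OF U] by (intro mult_right_mono) simp_all
  have q: "(1 + \<theta>) * mesh k / mesh k = 1 + \<theta>" by simp
  have "emeasure haar (cell_box (k, l1, l2)) =
      ennreal ((\<theta> * mesh k) * (\<theta> * mesh k) * ln ((1 + \<theta>) * mesh k / mesh k))"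
    unfolding cell_box_def prod.case
    by (subst emeasure_haar_box[OF le le U]) (use le[of 1] in \<open>simp_all add: d\<close>)
  then show ?thesis by (simp only: q power2_eq_square)
qed

lemma cell_box_sets: "cell_box m \<in> sets haar"
  unfolding cell_box_def by (cases m) (auto intro!: box_sets_haar)

text \<open>
  The number of cells of scale \<open>k\<close> compensates the area of their boxes, so all scales count equally.
\<close>

lemma emeasure_cells:
  "emeasure haar (\<Union>m\<in>cells. cell_box m) = ennreal (n * (\<theta>\<^sup>2 * ln (1 + \<theta>) * T\<^sup>2 * 16 ^ n))"
proof -
  let ?c = "\<theta>\<^sup>2 * ln (1 + \<theta>) * T\<^sup>2 * 16 ^ n"
  have ln: "ln (1 + \<theta>) \<ge> 0" using \<theta>_bounds by simp
  have "emeasure haar (\<Union>m\<in>cells. cell_box m) = (\<Sum>m\<in>cells. emeasure haar (cell_box m))"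
    by (intro sum_emeasure[symmetric] cell_box_disjoint finite_cells) (auto simp: cell_box_sets)
  also have "\<dots> = (\<Sum>m\<in>cells. ennreal ((\<theta> * mesh (fst m))\<^sup>2 * ln (1 + \<theta>)))"
    by (intro sum.cong refl) (metis emeasure_cell_box prod.collapse)
  also have "\<dots> = ennreal (\<Sum>m\<in>cells. (\<theta> * mesh (fst m))\<^sup>2 * ln (1 + \<theta>))"
    using ln by (intro sum_ennreal) auto
  also have "(\<Sum>m\<in>cells. (\<theta> * mesh (fst m))\<^sup>2 * ln (1 + \<theta>)) =
     (\<Sum>k<n. \<Sum>l\<in>{..<2 ^ (n - k)::nat} \<times> {..<2 ^ (n - k)::nat}. (\<theta> * mesh k)\<^sup>2 * ln (1 + \<theta>))"
    unfolding cells_def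
    using sum.Sigma[of "{..<n}" "\<lambda>k. {..<2 ^ (n - k)::nat} \<times> {..<2 ^ (n - k)::nat}"
        "\<lambda>k l. (\<theta> * mesh k)\<^sup>2 * ln (1 + \<theta>)"] by (simp add: case_prod_unfold)
  also have "\<dots> = (\<Sum>k<n. ?c)"
  proof (intro sum.cong refl)
    fix k assume "k \<in> {..<n}"
    then have "mesh k * 2 ^ (n - k) = T * 4 ^ n" using mesh_cells[of k] by simp
    then have "(mesh k * 2 ^ (n - k))\<^sup>2 = T\<^sup>2 * 16 ^ n"
      by (simp add: power_mult_distrib power2_eq_square[of "4 ^ n"] flip: power_mult_distrib)
         (simp add: power2_eq_square mult_ac flip: power_mult_distrib)
    then show "(\<Sum>l\<in>{..<2 ^ (n - k)::nat} \<times> {..<2 ^ (n - k)::nat}. (\<theta> * mesh k)\<^sup>2 * ln (1 + \<theta>)) = ?c"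
      by (simp add: card_cartesian_product power_mult_distrib power2_eq_square mult_ac)
  qed
  finally show ?thesis by simp
qed

text \<open>
  The left-hand side comes from integrating the pointwise bound over the union of the boxes; the right-hand
  side comes from summing the assumed bound over all sign patterns. The common factor
  \<open>2\<^bsup>card cells\<^esup> T\<^sup>2 16\<^sup>n n ln 2\<close> cancels.
\<close>

lemma sqrt_growth:
  assumes C: "C \<ge> 0" and cz: "10 * T \<le> 64 ^ n"
    and bound: "\<And>A. L1norm (TK (test_fun A)) \<le> ennreal (C * H1norm (test_fun A))"
  shows "\<kappa> * \<theta> ^ 4 * ln (1 + \<theta>) * sqrt n \<le> 200 * C"
proof -
  define \<rho> where "\<rho> = measure haar CZ_box"
  have Cb: "L1norm (TK (test_fun A)) \<le> ennreal (C * (4 * \<rho>))" for A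
  proof -
    have "C * H1norm (test_fun A) \<le> C * (4 * \<rho>)"
      unfolding \<rho>_def by (intro mult_left_mono H1norm_test_fun[OF cz] C)
    from order_trans[OF bound ennreal_leI[OF this]] show ?thesis .
  qed
  have int: "integrable haar (TK (test_fun A))" for A
    using Cb[of A] by (auto simp: L1norm_def top_unique split: if_splits)
  have nn: "(\<integral>\<^sup>+x. ennreal (norm (TK (test_fun A) x)) \<partial>haar) \<le> ennreal (C * (4 * \<rho>))" for A
    using Cb[of A] int[of A] by (simp add: L1norm_def)
  let ?D = "\<Union>m\<in>cells. cell_box m"
  let ?v = "2 ^ card cells * (8 * \<kappa> * \<theta>\<^sup>2 * (n * ln 2) / sqrt n)"
  let ?e = "n * (\<theta>\<^sup>2 * ln (1 + \<theta>) * T\<^sup>2 * 16 ^ n)"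
  have D: "?D \<in> sets haar" using cell_box_sets by (intro sets.finite_UN) auto
  have v: "?v \<ge> 0" using \<kappa>_pos by (intro mult_nonneg_nonneg divide_nonneg_nonneg) auto
  have \<rho>: "\<rho> \<ge> 0" by (simp add: \<rho>_def)
  have "ennreal (?v * ?e) = ennreal ?v * ennreal ?e"
    using v by (intro ennreal_mult') 
  also have "\<dots> = (\<integral>\<^sup>+x. ennreal ?v * indicator ?D x \<partial>haar)"
    using D by (simp add: nn_integral_cmult_indicator emeasure_cells)
  also have "\<dots> \<le> (\<integral>\<^sup>+x. (\<Sum>A\<in>Pow cells. ennreal (norm (TK (test_fun A) x))) \<partial>haar)"
  proof (rule nn_integral_mono)
    fix x
    show "ennreal ?v * indicator ?D x \<le> (\<Sum>A\<in>Pow cells. ennreal (norm (TK (test_fun A) x)))"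
    proof (cases "x \<in> ?D")
      case True
      then obtain m where "m \<in> cells" "x \<in> cell_box m" by auto
      then have "?v \<le> (\<Sum>A\<in>Pow cells. norm (TK (test_fun A) x))" by (rule sum_norm_TK_lower[rotated])
      then show ?thesis using True by (simp add: ennreal_leI sum_ennreal)
    qed simp
  qed
  also have "\<dots> = (\<Sum>A\<in>Pow cells. \<integral>\<^sup>+x. ennreal (norm (TK (test_fun A) x)) \<partial>haar)"
    using int by (intro nn_integral_sum) auto
  also have "\<dots> \<le> (\<Sum>A\<in>Pow cells. ennreal (C * (4 * \<rho>)))"
    by (intro sum_mono nn)
  also have "\<dots> = ennreal (2 ^ card cells * (C * (4 * \<rho>)))"
    using C \<rho> by (simp add: card_Pow ennreal_mult' ennreal_of_nat_eq_real_of_nat)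
  finally have "?v * ?e \<le> 2 ^ card cells * (C * (4 * \<rho>))"
    using C \<rho> by (simp add: ennreal_le_iff)
  then have "2 ^ card cells * ((8 * \<kappa> * \<theta>\<^sup>2 * (n * ln 2) / sqrt n) * ?e)
      \<le> 2 ^ card cells * (C * (4 * \<rho>))"
    by (simp only: mult.assoc)
  then have 1: "(8 * \<kappa> * \<theta>\<^sup>2 * (n * ln 2) / sqrt n) * ?e \<le> C * (4 * \<rho>)"
    by (rule mult_left_le_imp_le) simp
  have nl: "n * ln 2 \<ge> (1::real)"
  proof -
    have "ln 2 \<ge> (1/2 :: real)" using ln_le_minus_one[of "1/2::real"] by (simp add: ln_div)
    then have "2 * (1/2) \<le> n * ln (2::real)" using n_ge by (intro mult_mono) auto
    then show ?thesis by simp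
  qed
  have "\<rho> = 100 * T\<^sup>2 * 16 ^ n * (2 * (n * ln 2 + 1))" unfolding \<rho>_def by (rule measure_CZ_box)
  also have "\<dots> \<le> 100 * T\<^sup>2 * 16 ^ n * (4 * (n * ln 2))" using nl by (intro mult_left_mono) auto
  finally have "C * (4 * \<rho>) \<le> C * (4 * (100 * T\<^sup>2 * 16 ^ n * (4 * (n * ln 2))))"
    using C by (intro mult_left_mono) auto
  with 1 have 2: "(8 * \<kappa> * \<theta>\<^sup>2 * (n * ln 2) / sqrt n) * ?e
      \<le> C * (4 * (100 * T\<^sup>2 * 16 ^ n * (4 * (n * ln 2))))" by linarith
  have s: "real n / sqrt n = sqrt n" by (simp add: real_div_sqrt)
  have "(8 * \<kappa> * \<theta>\<^sup>2 * (n * ln 2) / sqrt n) * ?e =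
      8 * \<kappa> * \<theta> ^ 4 * ln (1 + \<theta>) * (real n / sqrt n) * (T\<^sup>2 * 16 ^ n * (n * ln 2))"
    by (simp add: power2_eq_square power4_eq_xxxx)
  then have "(8 * \<kappa> * \<theta> ^ 4 * ln (1 + \<theta>) * sqrt n) * (T\<^sup>2 * 16 ^ n * (n * ln 2))
      \<le> (1600 * C) * (T\<^sup>2 * 16 ^ n * (n * ln 2))"
    using 2 unfolding s by (simp add: mult_ac)
  moreover have "T\<^sup>2 * 16 ^ n * (n * ln 2) > 0" using T_ge nl n_ge by (intro mult_pos_pos) auto
  ultimately have "8 * \<kappa> * \<theta> ^ 4 * ln (1 + \<theta>) * sqrt n \<le> 1600 * C"
    by (rule mult_right_le_imp_le)
  then show ?thesis by (simp add: mult_ac)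
qed

end


section \<open>Unboundedness\<close>

text \<open>
  At \<open>(s, 0, 1)\<close>, \<open>cosh r = 1 + s\<^sup>2 / 2\<close> is at most \<open>3/2\<close> for \<open>\<bar>s\<bar> \<le> 1\<close> and at least 4 for
  \<open>\<bar>s\<bar> \<ge> 5/2\<close>. With these bounds the restriction of \<open>\<Psi>\<close> to this line is 1 on \<open>[- 1, 1]\<close> and 0 beyond
  \<open>\<plusminus> 5/2\<close>.
\<close>

lemma cosh_one_bounds: "3/2 < cosh (1::real)" "cosh (2::real) < 4"
proof -
  have e: "271/100 \<le> exp (1::real)" "exp 1 \<le> (272/100::real)"
    using e_approx_32 e_less_272 unfolding abs_le_iff by simp_all
  have c: "cosh (1::real) = (exp 1 + inverse (exp 1)) / 2"
    by (simp add: cosh_field_def exp_minus)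
  have "inverse (272/100) \<le> inverse (exp (1::real))" "inverse (exp (1::real)) \<le> inverse (271/100)"
    using le_imp_inverse_le[OF e(2)] le_imp_inverse_le[OF e(1)] by simp_all
  then show "3/2 < cosh (1::real)" using e c by simp
  have 1: "cosh (1::real) \<le> 155/100"
    using \<open>inverse (exp 1) \<le> _\<close> e c by simp
  have "cosh (2::real) = 2 * (cosh 1)\<^sup>2 - 1"
    using cosh_double_cosh[of "1::real"] by simp
  also have "(cosh (1::real))\<^sup>2 \<le> (155/100)\<^sup>2" using 1 by (intro power_mono) auto
  finally show "cosh (2::real) < 4" by (simp add: power2_eq_square)
qed

lemma not_in_hball_2:
  assumes "z \<in> G" "8 \<le> snd (snd z) + 1 / snd (snd z) + ((fst z)\<^sup>2 + (fst (snd z))\<^sup>2) / snd (snd z)"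
  shows "z \<in> G - hball 2"
proof -
  obtain x y a where z: "z = (x, y, a)" by (cases z)
  have G: "(x, y, a) \<in> G" using assms(1) z by simp
  have "cosh 2 < cosh (hrad z)"
    using cosh_hrad(1)[OF G] assms(2) cosh_one_bounds(2) by (simp add: z)
  then have "2 < hrad z" using cosh_hrad(2)[OF G] by (subst (asm) cosh_real_nonneg_less_iff) (auto simp: z)
  then show ?thesis using assms(1) by (simp add: hball_def)
qed

lemma in_hball_1:
  assumes "\<bar>s\<bar> \<le> 1" shows "(s, 0, 1) \<in> hball 1"
proof -
  have G: "(s, 0, 1) \<in> G" by (simp add: G_def)
  have "s\<^sup>2 \<le> 1" using assms by (simp add: abs_square_le_1)
  then have "cosh (hrad (s, 0, 1)) < cosh 1"
    using cosh_hrad(1)[OF G] cosh_one_bounds(1) by simp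
  then have "hrad (s, 0, 1) < 1"
    using cosh_hrad(2)[OF G] by (subst (asm) cosh_real_nonneg_less_iff) auto
  then show ?thesis using G by (simp add: hball_def)
qed

lemma Riesz_form_near:
  assumes "v > 0" "\<epsilon> > 0"
  obtains \<delta> where "\<delta> > 0"
    "\<And>t x' y' v'. \<lbrakk>\<bar>t\<bar> \<le> \<delta>; \<bar>x' - x\<bar> \<le> \<delta>; \<bar>y' - y\<bar> \<le> \<delta>; \<bar>v' - v\<bar> \<le> \<delta>\<rbrakk> \<Longrightarrow>
       \<bar>Riesz_form i j t (x', y', v') - Riesz_form i j 0 (x, y, v)\<bar> \<le> \<epsilon>"
proof -
  have "qform 0 (x, y, v) > 0" using assms by (intro qform_pos) auto
  then have "isCont (\<lambda>(t, z). Riesz_form i j t z) (0, (x, y, v))" by (rule Riesz_form_isCont)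
  then obtain d where d: "d > 0" "\<And>w. dist w (0, (x, y, v)) < d \<Longrightarrow>
      dist ((\<lambda>(t, z). Riesz_form i j t z) w) (Riesz_form i j 0 (x, y, v)) < \<epsilon>"
    unfolding continuous_at_eps_delta using assms(2) by fastforce
  show ?thesis
  proof (rule that[of "d / 5"])
    fix t x' y' v' :: real
    assume h: "\<bar>t\<bar> \<le> d / 5" "\<bar>x' - x\<bar> \<le> d / 5" "\<bar>y' - y\<bar> \<le> d / 5" "\<bar>v' - v\<bar> \<le> d / 5"
    have dp: "dist (a, b) (c, e) \<le> dist a c + dist b e" for a c :: real and b e :: "'z::metric_space"
      unfolding dist_Pair_Pair by (rule sqrt_sum_squares_le_sum) auto
    have "dist (t, (x', (y', v'))) (0, (x, (y, v))) \<le> \<bar>t\<bar> + (\<bar>x' - x\<bar> + (\<bar>y' - y\<bar> + \<bar>v' - v\<bar>))"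
      using dp[of t "(x', (y', v'))" 0 "(x, (y, v))"] dp[of x' "(y', v')" x "(y, v)"] dp[of y' v' y v]
      by (simp add: dist_real_def)
    also have "\<dots> < d" using h d(1) by linarith
    finally have "dist (t, (x', (y', v'))) (0, (x, (y, v))) < d" .
    from d(2)[OF this] show "\<bar>Riesz_form i j t (x', y', v') - Riesz_form i j 0 (x, y, v)\<bar> \<le> \<epsilon>"
      by (simp add: dist_real_def)
  qed (use d in auto)
qed

theorem theorem9p4:
  fixes \<Psi> :: "pt \<Rightarrow> real" and i j :: nat
  assumes "\<Psi> \<in> test_functions"
    and "\<And>x. x \<in> G \<Longrightarrow> 0 \<le> \<Psi> x \<and> \<Psi> x \<le> 1"
    and "\<And>x. x \<in> G - hball 2 \<Longrightarrow> \<Psi> x = 0"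
    and "\<And>x. x \<in> hball 1 \<Longrightarrow> \<Psi> x = 1"
    and "i \<in> {0, 1, 2}" and "j \<in> {0, 1, 2}"
  shows "\<not> bounded_H1_L1 (Riesz_global \<Psi> i j)"
proof
  assume "bounded_H1_L1 (Riesz_global \<Psi> i j)"
  then obtain C where C: "C \<ge> 0" "\<And>f. f \<in> test_functions \<inter> H1 \<Longrightarrow>
      L1norm (Riesz_global \<Psi> i j f) \<le> ennreal (C * H1norm f)"
    unfolding bounded_H1_L1_def by blast
  \<comment> \<open>The given cutoff supplies the smooth bump in one variable.\<close>
  define P where "P s = \<Psi> (s, 0, 1)" for s
  have P_smooth: "Ck_on k UNIV P" for k
  proof -
    have b: "bounded_linear (\<lambda>s::real. (s, 0::real, 0::real))"
      by (intro bounded_linear_Pair bounded_linear_ident bounded_linear_zero)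
    have "Ck_on k UNIV (\<lambda>s::real. \<Psi> ((s, 0, 0) + (0, 0, 1)))"
      by (rule Ck_on_affine_comp[OF open_UNIV b, of _ G])
        (use assms(1) in \<open>auto simp: G_def test_functions_def smooth_on_def\<close>)
    then show ?thesis by (simp add: P_def[abs_def])
  qed
  define K where "K = Riesz_kernel_global \<Psi> i j"
  have K: "K y = Riesz_form i j 1 y" if "snd (snd y) \<ge> 10" for y
  proof -
    have G: "y \<in> G" using that by (cases y) (simp add: G_def)
    have "y \<in> G - hball 2" using that by (intro not_in_hball_2[OF G]) (auto intro!: add_increasing2)
    then show ?thesis using assms(3) that by (simp add: K_def Riesz_kernel_global_def Riesz_kernel_eq)
  qed
  define \<alpha> where "\<alpha> = Riesz_form i j 0 (1, 1, 1)"
  define \<beta> where "\<beta> = Riesz_form i j 0 (0, 0, 1)"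
  define \<sigma> where "\<sigma> = sgn (\<alpha> - \<beta>)"
  define \<kappa> where "\<kappa> = \<bar>\<alpha> - \<beta>\<bar> / 4"
  define \<mu> where "\<mu> = \<sigma> * (\<alpha> + \<beta>) / 2"
  have ne: "\<alpha> \<noteq> \<beta>" unfolding \<alpha>_def \<beta>_def by (rule Riesz_form_nonconstant) fact+
  then have \<kappa>: "\<kappa> > 0" and \<sigma>: "\<bar>\<sigma>\<bar> = 1" by (auto simp: \<kappa>_def \<sigma>_def abs_sgn_eq)
  have \<sigma>\<alpha>: "\<sigma> * \<alpha> = \<mu> + 2 * \<kappa>" and \<sigma>\<beta>: "\<sigma> * \<beta> = \<mu> - 2 * \<kappa>"
    by (auto simp: \<sigma>_def \<mu>_def \<kappa>_def sgn_if field_simps)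
  obtain d1 where d1: "d1 > 0" "\<And>t x y v. \<lbrakk>\<bar>t\<bar> \<le> d1; \<bar>x - 1\<bar> \<le> d1; \<bar>y - 1\<bar> \<le> d1; \<bar>v - 1\<bar> \<le> d1\<rbrakk> \<Longrightarrow>
       \<bar>Riesz_form i j t (x, y, v) - \<alpha>\<bar> \<le> \<kappa>"
    unfolding \<alpha>_def using Riesz_form_near[of 1 \<kappa> 1 1 i j] \<kappa> by auto
  obtain d0 where d0: "d0 > 0" "\<And>t x y v. \<lbrakk>\<bar>t\<bar> \<le> d0; \<bar>x - 0\<bar> \<le> d0; \<bar>y - 0\<bar> \<le> d0; \<bar>v - 1\<bar> \<le> d0\<rbrakk> \<Longrightarrow>
       \<bar>Riesz_form i j t (x, y, v) - \<beta>\<bar> \<le> \<kappa>"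
    unfolding \<beta>_def using Riesz_form_near[of 1 \<kappa> 0 0 i j] \<kappa> by auto
  \<comment> \<open>Tolerances: offsets within \<open>4 \<theta>\<close> and dilations up to \<open>5 / (2 T)\<close> must both lie within \<open>d\<close>.\<close>
  define d where "d = min d0 d1"
  have d: "d > 0" "d \<le> d0" "d \<le> d1" using d0(1) d1(1) by (auto simp: d_def)
  define \<theta> where "\<theta> = min (1/8) (d / 4)"
  have \<theta>: "0 < \<theta>" "\<theta> \<le> 1/8" "4 * \<theta> \<le> d" using d by (auto simp: \<theta>_def)
  define T where "T = max 25 (5 / (2 * d))"
  have T: "T \<ge> 25" by (simp add: T_def)
  have Td: "5 / (2 * T) \<le> d"
  proof -
    have "5 / (2 * d) \<le> T" by (simp add: T_def)
    then show ?thesis using d(1) T by (simp add: field_simps)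
  qed
  have growth: "\<kappa> * \<theta> ^ 4 * ln (1 + \<theta>) * sqrt n \<le> 200 * C" if n: "n \<ge> 2" "10 * T \<le> 64 ^ n" for n
  proof -
    interpret Riesz_test P T \<theta> n i j K \<sigma> \<mu> \<kappa>
    proof
      show "continuous_on UNIV P" using P_smooth[of 0] by simp
      show "0 \<le> P s" "P s \<le> 1" for s using assms(2)[of "(s, 0, 1)"] by (auto simp: P_def G_def)
      show "P s = 1" if "\<bar>s\<bar> \<le> 1" for s using assms(4) in_hball_1[OF that] by (simp add: P_def)
      show "P s = 0" if "5/2 \<le> \<bar>s\<bar>" for s
      proof -
        have "(5/2)\<^sup>2 \<le> \<bar>s\<bar>\<^sup>2" using that by (intro power_mono) auto
        then have "s\<^sup>2 \<ge> 6" by (simp add: power2_eq_square)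
        then have "(s, 0, 1) \<in> G - hball 2" by (intro not_in_hball_2) (auto simp: G_def)
        then show ?thesis using assms(3) by (simp add: P_def)
      qed
      show "\<mu> + \<kappa> \<le> \<sigma> * Riesz_form i j t (x, y, v)"
        if "0 < t" "t \<le> 5 / (2 * T)" "\<bar>x - 1\<bar> \<le> 4 * \<theta>" "\<bar>y - 1\<bar> \<le> 4 * \<theta>" "1 \<le> v" "v \<le> 1 + \<theta>" for t x y v
      proof -
        have "\<bar>Riesz_form i j t (x, y, v) - \<alpha>\<bar> \<le> \<kappa>"
          using that \<theta> d Td by (intro d1(2)) linarith+
        then have "\<bar>\<sigma> * Riesz_form i j t (x, y, v) - \<sigma> * \<alpha>\<bar> \<le> \<kappa>"
          using \<sigma> by (simp add: right_diff_distrib[symmetric] abs_mult)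
        then show ?thesis using \<sigma>\<alpha> by linarith
      qed
      show "\<sigma> * Riesz_form i j t (x, y, v) \<le> \<mu> - \<kappa>"
        if "0 < t" "t \<le> 5 / (2 * T)" "\<bar>x\<bar> \<le> 4 * \<theta>" "\<bar>y\<bar> \<le> 4 * \<theta>" "1 \<le> v" "v \<le> 1 + \<theta>" for t x y v
      proof -
        have "\<bar>Riesz_form i j t (x, y, v) - \<beta>\<bar> \<le> \<kappa>"
          using that \<theta> d Td by (intro d0(2)) linarith+
        then have "\<bar>\<sigma> * Riesz_form i j t (x, y, v) - \<sigma> * \<beta>\<bar> \<le> \<kappa>"
          using \<sigma> by (simp add: right_diff_distrib[symmetric] abs_mult)
        then show ?thesis using \<sigma>\<beta> by linarith
      qed
    qed (use T \<theta> n K \<sigma> \<kappa> in auto)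
    show ?thesis
    proof (rule sqrt_growth[OF C(1) n(2)])
      show "L1norm (TK (test_fun A)) \<le> ennreal (C * H1norm (test_fun A))" for A
        using C(2)[of "test_fun A"] test_fun_smooth[OF P_smooth] test_fun_H1[OF n(2)]
        by (simp add: Riesz_global_def K_def)
    qed
  qed
  define c where "c = \<kappa> * \<theta> ^ 4 * ln (1 + \<theta>)"
  have c: "c > 0" unfolding c_def using \<kappa> \<theta> by (intro mult_pos_pos) auto
  \<comment> \<open>The middle condition guarantees the upper bound on the side of a Calderon-Zygmund set.\<close>
  obtain n where n: "n \<ge> 2" "10 * T \<le> 64 ^ n" "200 * C < c * sqrt n"
  proof -
    obtain m :: nat where m: "real m > max (10 * T) ((200 * C / c)\<^sup>2 + 2)"
      using reals_Archimedean2 by blast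
    have "real m < 2 ^ m" by (rule of_nat_less_two_power)
    also have "\<dots> \<le> 64 ^ m" by (intro power_mono) auto
    finally have "real m < 64 ^ m" .
    moreover have "200 * C / c < sqrt m"
      using m by (intro real_less_rsqrt) auto
    then have "200 * C < c * sqrt m" using c by (simp add: pos_divide_less_eq mult.commute)
    moreover have "real m \<ge> 2" using m by (smt (verit) zero_le_power2)
    ultimately show ?thesis using m by (intro that[of m]) linarith+
  qed
  show False using growth[OF n(1,2)] n(3) by (simp add: c_def)
qed

end
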